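(* Let $(\mathcal{C},d_{\mathcal{C}})$ be an $n$-dimensional Hilbert geometry. The upper $n$-asymptotic volume is finite if and only if $\mathcal{C}$ is a polytope, i.e., $$\overline{\mathrm{Asvol}_n}(\mathcal{C})=\limsup_{r\to+\infty}\frac{\mathrm{Vol}_{\mathcal{C}}\bigl(B_{\mathcal{C}}(x,r)\bigr)}{r^n}<+\infty\iff \mathcal{C}\text{ is a polytope}.$$
   Context: An $n$-dimensional Hilbert geometry $(\mathcal{C},d_{\mathcal{C}})$ is a nonempty open convex set $\mathcal{C}\subset\mathbb{R}^n$ that contains no whole line, endowed with the Hilbert distance: $d_{\mathcal{C}}(p,p)=0$, and for distinct $p,q\in\mathcal{C}$, if the line $pq$ meets $\partial\mathcal{C}$ at $a,b$ with $a,p,q,b$ in this order on the line, $$d_{\mathcal{C}}(p,q)=\frac12\ln\left(\frac{\|q-a\|}{\|p-a\|}\cdot\frac{\|p-b\|}{\|q-b\|}\right),$$ where $\|\cdot\|$ is the Euclidean norm; if $a$ or $b$ is at infinity the corresponding ratio is taken equal to $1$. $B_{\mathcal{C}}(x,r)$ is the metric ball of radius $r$ centred at a point $x\in\mathcal{C}$. Finsler metric: for $p\in\mathcal{C}$ and $v\in\mathbb{R}^n\setminus\{0\}$, let $t^+,t^->0$ be such that $p+t^+v\in\partial\mathcal{C}$ and $p-t^-v\in\partial\mathcal{C}$ (with $1/t^\pm=0$ if the corresponding boundary point is at infinity); set $F_{\mathcal{C}}(p,v)=\frac12\left(\frac1{t^+}+\frac1{t^-}\right)$ and $F_{\mathcal{C}}(p,0)=0$.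 $\mathrm{Vol}_{\mathcal{C}}$ is the Busemann volume: let $\beta_{\mathcal{C}}(p)=\{v\in\mathbb{R}^n : F_{\mathcal{C}}(p,v)<1\}$, let $\mathrm{Leb}$ be Lebesgue measure and $\omega_n$ the Euclidean volume of the Euclidean unit ball of $\mathbb{R}^n$; then $\mathrm{Vol}_{\mathcal{C}}(A)=\int_A \frac{\omega_n}{\mathrm{Leb}(\beta_{\mathcal{C}}(p))}\,d\mathrm{Leb}(p)$ for Borel $A\subset\mathcal{C}$. The upper $n$-asymptotic volume is the limsup displayed in the claim, with $x\in\mathcal{C}$ (the notation omits $x$). Being open, $\mathcal{C}$ is called a polytope when it is the interior of a convex polytope. *)

theory Defs
  imports "HOL-Analysis.Analysis"
begin

definition hilbert_geometry :: "(real ^ 'n) set \<Rightarrow> bool" where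
  "hilbert_geometry C \<longleftrightarrow>
     C \<noteq> {} \<and> open C \<and> convex C \<and>
     \<not> (\<exists>p v. v \<noteq> 0 \<and> range (\<lambda>t::real. p + t *\<^sub>R v) \<subseteq> C)"

text \<open>
  \<open>boundary_beyond C p q b\<close>: \<open>b\<close> is a boundary point of \<open>C\<close> on the line \<open>pq\<close>, and
  \<open>p\<close>, \<open>q\<close>, \<open>b\<close> lie in this order.  If no such point exists, it is ``at infinity''.
\<close>

definition boundary_beyond :: "(real ^ 'n) set \<Rightarrow> real ^ 'n \<Rightarrow> real ^ 'n \<Rightarrow> real ^ 'n \<Rightarrow> bool" where
  "boundary_beyond C p q b \<longleftrightarrow> b \<in> frontier C \<and> q \<in> open_segment p b"

definition hilbert_ratio :: "(real ^ 'n) set \<Rightarrow> real ^ 'n \<Rightarrow> real ^ 'n \<Rightarrow> real" where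
  "hilbert_ratio C p q =
     (if \<exists>b. boundary_beyond C p q b
      then (let b = (THE b. boundary_beyond C p q b) in norm (p - b) / norm (q - b))
      else 1)"

text \<open>
  The factor \<open>hilbert_ratio C q p\<close> is \<open>\<parallel>q - a\<parallel> / \<parallel>p - a\<parallel>\<close>, where \<open>a\<close> is the boundary point
  on the other side, i.e. the one beyond \<open>p\<close> as seen from \<open>q\<close>.
\<close>

definition hilbert_dist :: "(real ^ 'n) set \<Rightarrow> real ^ 'n \<Rightarrow> real ^ 'n \<Rightarrow> real" where
  "hilbert_dist C p q =
     (if p = q then 0 else 1/2 * ln (hilbert_ratio C q p * hilbert_ratio C p q))"

definition hilbert_ball :: "(real ^ 'n) set \<Rightarrow> real ^ 'n \<Rightarrow> real \<Rightarrow> (real ^ 'n) set" where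
  "hilbert_ball C x r = {y \<in> C. hilbert_dist C x y < r}"

text \<open>
  \<open>inverse_exit_time C p v\<close> is \<open>1 / t\<close> for the \<open>t > 0\<close> with \<open>p + t v\<close> on the boundary of \<open>C\<close>,
  and \<open>0\<close> if the ray from \<open>p\<close> in direction \<open>v\<close> does not meet the boundary.
\<close>

definition inverse_exit_time :: "(real ^ 'n) set \<Rightarrow> real ^ 'n \<Rightarrow> real ^ 'n \<Rightarrow> real" where
  "inverse_exit_time C p v =
     (if \<exists>t>0. p + t *\<^sub>R v \<in> frontier C
      then 1 / (THE t. t > 0 \<and> p + t *\<^sub>R v \<in> frontier C)
      else 0)"

definition finsler :: "(real ^ 'n) set \<Rightarrow> real ^ 'n \<Rightarrow> real ^ 'n \<Rightarrow> real" where
  "finsler C p v =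
     (if v = 0 then 0 else 1/2 * (inverse_exit_time C p v + inverse_exit_time C p (- v)))"

definition finsler_ball :: "(real ^ 'n) set \<Rightarrow> real ^ 'n \<Rightarrow> (real ^ 'n) set" where
  "finsler_ball C p = {v. finsler C p v < 1}"

definition busemann_volume :: "(real ^ 'n) set \<Rightarrow> (real ^ 'n) set \<Rightarrow> ennreal" where
  "busemann_volume C A =
     (\<integral>\<^sup>+p\<in>A. (emeasure lborel (ball (0 :: real ^ 'n) 1) / emeasure lborel (finsler_ball C p)) \<partial>lborel)"

definition upper_asvol :: "(real ^ 'n) set \<Rightarrow> real ^ 'n \<Rightarrow> ennreal" where
  "upper_asvol C x =
     Limsup at_top (\<lambda>r::real. busemann_volume C (hilbert_ball C x r) / ennreal (r ^ CARD('n)))"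

text \<open>
  Since \<open>C\<close> may be unbounded, ``convex polytope'' is understood as a finite intersection of closed
  half-spaces, bounded or not: an open orthant is projectively equivalent to, hence isometric to, an
  open simplex.  For bounded \<open>C\<close> this is the interior of the convex hull of finitely many points,
  see \<open>open_polytope_bounded_iff\<close> below.
\<close>

definition open_polytope :: "(real ^ 'n) set \<Rightarrow> bool" where
  "open_polytope C \<longleftrightarrow> (\<exists>P. polyhedron P \<and> C = interior P)"

lemma open_polytope_bounded_iff:
  fixes C :: "(real ^ 'n) set"
  assumes "hilbert_geometry C" "bounded C"
  shows "open_polytope C \<longleftrightarrow> (\<exists>P. polytope P \<and> C = interior P)"
proof
  assume "open_polytope C"
  then obtain P where P: "polyhedron P" "C = interior P"
    unfolding open_polytope_def by blast
  have "closure (interior P) = closure P"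
    using assms(1) P(2) convex_closure_interior[OF polyhedron_imp_convex[OF P(1)]]
    unfolding hilbert_geometry_def by blast
  then have "P = closure C"
    using P(2) closure_closed[OF polyhedron_imp_closed[OF P(1)]] by metis
  then have "bounded P"
    using bounded_closure[OF assms(2)] by simp
  then show "\<exists>P. polytope P \<and> C = interior P"
    using P polytope_eq_bounded_polyhedron by blast
next
  assume "\<exists>P. polytope P \<and> C = interior P"
  then show "open_polytope C"
    unfolding open_polytope_def using polytope_imp_polyhedron by blast
qed

text \<open>The boundary points and exit times selected above by \<open>THE\<close> are unique.\<close>

lemma open_segment_to_frontier:
  fixes C :: "(real ^ 'n) set"
  assumes "hilbert_geometry C" "p \<in> C" "b \<in> frontier C" "x \<in> open_segment p b"
  shows "x \<notin> frontier C"
proof -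
  have "open C" "convex C"
    using assms(1) unfolding hilbert_geometry_def by blast+
  then have "open_segment p b \<subseteq> interior C"
    using in_interior_closure_convex_segment[of C p b] assms(2,3)
    by (simp add: frontier_def interior_open)
  then show ?thesis
    using assms(4) unfolding frontier_def by blast
qed

lemma exit_time_unique:
  fixes C :: "(real ^ 'n) set"
  assumes C: "hilbert_geometry C" "p \<in> C" "v \<noteq> 0"
    and s: "s > 0" "p + s *\<^sub>R v \<in> frontier C" and t: "t > 0" "p + t *\<^sub>R v \<in> frontier C"
  shows "s = t"
proof -
  have aux: False
    if st: "0 < s" "s < t" "p + s *\<^sub>R v \<in> frontier C" "p + t *\<^sub>R v \<in> frontier C" for s t :: real
  proof -
    have "p + s *\<^sub>R v = (1 - s/t) *\<^sub>R p + (s/t) *\<^sub>R (p + t *\<^sub>R v)"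
      using st by (simp add: algebra_simps)
    then have "p + s *\<^sub>R v \<in> open_segment p (p + t *\<^sub>R v)"
      using st \<open>v \<noteq> 0\<close> unfolding in_segment by (intro conjI exI[of _ "s/t"]) auto
    then show False
      using open_segment_to_frontier[OF C(1,2)] st by blast
  qed
  show ?thesis
    using aux[of s t] aux[of t s] s t by (meson linorder_neqE)
qed

lemma boundary_beyond_unique:
  fixes C :: "(real ^ 'n) set"
  assumes C: "hilbert_geometry C" "p \<in> C"
    and b: "boundary_beyond C p q b" and b': "boundary_beyond C p q b'"
  shows "b = b'"
proof -
  have *: "\<exists>t>0. c = p + t *\<^sub>R (q - p) \<and> q \<noteq> p" if "q \<in> open_segment p c" for c
  proof -
    from that obtain u where "p \<noteq> c" "0 < u" "q = (1 - u) *\<^sub>R p + u *\<^sub>R c"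
      unfolding in_segment by blast
    then have "q - p = u *\<^sub>R (c - p)" by (simp add: algebra_simps)
    then show ?thesis
      using \<open>0 < u\<close> \<open>p \<noteq> c\<close> by (intro exI[of _ "1/u"]) auto
  qed
  obtain s where s: "s > 0" "b = p + s *\<^sub>R (q - p)" "q \<noteq> p"
    using * b unfolding boundary_beyond_def by blast
  obtain t where t: "t > 0" "b' = p + t *\<^sub>R (q - p)"
    using * b' unfolding boundary_beyond_def by blast
  have "s = t"
    using exit_time_unique[OF C, of "q - p" s t] s t b b' unfolding boundary_beyond_def by auto
  then show ?thesis using s t by simp
qed

end

theory Submission
  imports Defs
begin

text \<open>
  Why the theorem holds.  For points \<open>p\<close>, \<open>q\<close> of a convex set, \<open>hilbert_near C k p q\<close> says that \<open>q\<close> divides a segment from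
  \<open>p\<close> to a point of \<open>C\<close>, \<open>p\<close> divides one from \<open>q\<close> to a point of \<open>C\<close>, and the product of the two ratios is at most
  \<open>k\<close>.  This is the inequality \<open>d(p, q) \<le> ln k / 2\<close> for the Hilbert distance, up to boundary cases, but in a form
  that makes sense for convex sets of every dimension.  It is inherited by affine slices, it is invariant under projective
  maps, and it bounds quotients of positive affine functions.  Volumes are compared through the symmetric body
  \<open>(C - p) \<inter> (p - C)\<close>, which lies between the Finsler ball at \<open>p\<close> and half of it.

  Let \<open>C\<close> be cut out by finitely many positive affine functions.  At a point \<open>p\<close> choose \<open>n\<close> of their linear parts,
  divided by the values at \<open>p\<close>, with the largest determinant.  By Cramer's rule the other ones are combinations of
  these with coefficients in \<open>[-1, 1]\<close>, so the Finsler ball at \<open>p\<close> is comparable to the parallelepiped defined by these \<open>n\<close>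
  functions alone (\<open>dominating_normals\<close>).  In the logarithms of the \<open>n\<close> functions the Busemann volume is then
  bounded by a constant on each unit cube (\<open>cell_volume_le\<close>), and a ball of radius \<open>r\<close> meets only \<open>O(r ^ n)\<close> unit
  cubes, since the logarithms vary by at most \<open>2 * r\<close> from the centre.  As there are finitely many choices of \<open>n\<close>
  functions, the volume is \<open>O(r ^ n)\<close>.

  For the converse, separated points have disjoint neighbourhoods whose volume is bounded below by a universal constant
  (\<open>busemann_volume_ge_packing\<close>), so it suffices to find many separated points in a ball.  In dimension \<open>k\<close> there are
  always at least \<open>N ^ k\<close> of them in a ball of radius of order \<open>N\<close>, with universal constants (\<open>polynomial_packing\<close>):
  approach a boundary point, cut along hyperplanes parallel to a supporting hyperplane at \<open>N\<close> exponentially decreasing heights, and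
  use induction in the slices.  At an exposed point these slices shrink to the point, so different exposed points have
  disjoint families of slices, and \<open>M\<close> exposed points give \<open>M * N ^ n\<close> separated points (\<open>exposed_packing\<close>).
  Finite asymptotic volume therefore bounds the number of exposed points, and a compact convex set with finitely many
  exposed points is a polytope (\<open>finitely_many_exposed_imp_polytope\<close>).  An unbounded \<open>C\<close> is first mapped to a bounded
  convex set by a projective map (\<open>hilbert_near_proj\<close>, \<open>proj_section\<close>); this is possible because \<open>C\<close> contains no line.
\<close>

section \<open>Closeness in a convex set\<close>

text \<open>
  For \<open>l > 1\<close> the point \<open>q\<close> divides a segment from \<open>p\<close> to a point \<open>c\<close> of \<open>C\<close>, and \<open>l\<close> is the ratio
  \<open>\<parallel>p - c\<parallel> / \<parallel>q - c\<parallel>\<close>.  When \<open>C\<close> is open and convex and \<open>p \<noteq> q\<close> lie in \<open>C\<close>, these \<open>l\<close> are exactly the numbers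
  above the factor of the Hilbert distance that belongs to the boundary point beyond \<open>q\<close>.  Without denominators the
  condition also makes sense for \<open>l = 1\<close>, and then it says \<open>p = q\<close>.
\<close>

definition reach :: "'a::real_vector set \<Rightarrow> real \<Rightarrow> 'a \<Rightarrow> 'a \<Rightarrow> bool" where
  "reach C l p q \<longleftrightarrow> 1 \<le> l \<and> (\<exists>c\<in>C. l *\<^sub>R q = p + (l - 1) *\<^sub>R c)"

text \<open>
  In an open convex set the infimum of all such \<open>k\<close> is \<open>exp (2 * d(p, q))\<close> with \<open>d\<close> the Hilbert distance.  The two
  ratios enter only through their product because the product alone is a projective invariant.
\<close>

definition hilbert_near :: "'a::real_vector set \<Rightarrow> real \<Rightarrow> 'a \<Rightarrow> 'a \<Rightarrow> bool" where
  "hilbert_near C k p q \<longleftrightarrow> (\<exists>l m. l * m \<le> k \<and> reach C l p q \<and> reach C m q p)"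

lemma hilbert_nearI: "reach C l p q \<Longrightarrow> reach C m q p \<Longrightarrow> l * m \<le> k \<Longrightarrow> hilbert_near C k p q"
  unfolding hilbert_near_def by blast

lemma reach_refl: "p \<in> C \<Longrightarrow> reach C 1 p p"
  unfolding reach_def by auto

lemma reach_ge_1: "reach C l p q \<Longrightarrow> 1 \<le> l"
  unfolding reach_def by blast

text \<open>
  Convexity with weights that need not add up to one, so that no division is needed when ratios are combined.
\<close>

lemma convex_weighted:
  assumes "convex C" "c \<in> C" "d \<in> C" "0 \<le> a" "0 \<le> b"
  shows "\<exists>e\<in>C. a *\<^sub>R c + b *\<^sub>R d = (a + b) *\<^sub>R e"
proof (cases "a + b = 0")
  case True
  then have "a = 0" "b = 0" using assms by auto
  then show ?thesis using assms(2) by auto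
next
  case False
  then have pos: "a + b > 0" using assms by auto
  have "(a / (a + b)) *\<^sub>R c + (b / (a + b)) *\<^sub>R d \<in> C"
    using assms pos by (intro convexD[OF assms(1)]) (auto simp: add_divide_distrib[symmetric])
  moreover have "(a + b) *\<^sub>R ((a / (a + b)) *\<^sub>R c + (b / (a + b)) *\<^sub>R d) = a *\<^sub>R c + b *\<^sub>R d"
    using pos by (simp add: scaleR_add_right)
  ultimately show ?thesis by metis
qed

text \<open>
  Substituting one equation into the other produces a combination of the two witnesses in \<open>C\<close>; this is the triangle
  inequality for the logarithm of the ratio.
\<close>

lemma reach_trans:
  assumes "convex C" "reach C l p q" "reach C m q w"
  shows "reach C (l * m) p w"
proof -
  obtain c d where c: "c \<in> C" "l *\<^sub>R q = p + (l - 1) *\<^sub>R c" and d: "d \<in> C" "m *\<^sub>R w = q + (m - 1) *\<^sub>R d"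
    and lm: "1 \<le> l" "1 \<le> m"
    using assms unfolding reach_def by blast
  have "l * (m - 1) \<ge> 0" using lm by auto
  then obtain e where e: "e \<in> C"
    "(l - 1) *\<^sub>R c + (l * (m - 1)) *\<^sub>R d = ((l - 1) + l * (m - 1)) *\<^sub>R e"
    using convex_weighted[OF assms(1) c(1) d(1), of "l - 1" "l * (m - 1)"] lm by auto
  have "(l * m) *\<^sub>R w = l *\<^sub>R (m *\<^sub>R w)" by simp
  also have "\<dots> = p + ((l - 1) *\<^sub>R c + (l * (m - 1)) *\<^sub>R d)"
    using c(2) d(2) by (simp add: scaleR_add_right)
  also have "\<dots> = p + (l * m - 1) *\<^sub>R e"
    unfolding e(2) by (simp add: algebra_simps)
  finally show ?thesis
    using e(1) lm mult_mono[of 1 l 1 m] unfolding reach_def by auto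
qed

lemma reach_mono:
  assumes "convex C" "reach C l p q" "q \<in> C" "l \<le> l'"
  shows "reach C l' p q"
proof -
  obtain c where c: "c \<in> C" "l *\<^sub>R q = p + (l - 1) *\<^sub>R c" "1 \<le> l"
    using assms unfolding reach_def by blast
  obtain e where e: "e \<in> C" "(l - 1) *\<^sub>R c + (l' - l) *\<^sub>R q = ((l - 1) + (l' - l)) *\<^sub>R e"
    using convex_weighted[OF assms(1) c(1) assms(3), of "l - 1" "l' - l"] c assms by auto
  have "l' *\<^sub>R q = l *\<^sub>R q + (l' - l) *\<^sub>R q" by (simp add: algebra_simps)
  also have "\<dots> = p + ((l - 1) *\<^sub>R c + (l' - l) *\<^sub>R q)" using c(2) by simp
  also have "\<dots> = p + (l' - 1) *\<^sub>R e" unfolding e(2) by simp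
  finally show ?thesis using e c assms unfolding reach_def by auto
qed

lemma reach_subset: "reach C l p q \<Longrightarrow> C \<subseteq> D \<Longrightarrow> reach D l p q"
  unfolding reach_def by blast

lemma hilbert_near_subset: "hilbert_near C k p q \<Longrightarrow> C \<subseteq> D \<Longrightarrow> hilbert_near D k p q"
  unfolding hilbert_near_def using reach_subset by blast

lemma hilbert_near_mono: "hilbert_near C k p q \<Longrightarrow> k \<le> k' \<Longrightarrow> hilbert_near C k' p q"
  unfolding hilbert_near_def using order_trans by blast

lemma hilbert_near_sym: "hilbert_near C k p q \<Longrightarrow> hilbert_near C k q p"
  unfolding hilbert_near_def by (metis mult.commute)

lemma hilbert_near_refl: "p \<in> C \<Longrightarrow> hilbert_near C 1 p p"
  unfolding hilbert_near_def using reach_refl by force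

lemma hilbert_near_trans:
  assumes "convex C" "hilbert_near C k p q" "hilbert_near C k' q w"
  shows "hilbert_near C (k * k') p w"
proof -
  obtain l m where lm: "l * m \<le> k" "reach C l p q" "reach C m q p"
    using assms unfolding hilbert_near_def by blast
  obtain l' m' where lm': "l' * m' \<le> k'" "reach C l' q w" "reach C m' w q"
    using assms unfolding hilbert_near_def by blast
  have pos: "1 \<le> l" "1 \<le> m" "1 \<le> l'" "1 \<le> m'" using lm lm' reach_ge_1 by blast+
  have "(l * m) * (l' * m') \<le> k * k'"
    using lm(1) lm'(1) pos by (intro mult_mono) (auto intro: order_trans[of 0 "l * m"])
  then have "(l * l') * (m' * m) \<le> k * k'" by (simp add: algebra_simps)
  then show ?thesis
    using reach_trans[OF assms(1) lm(2) lm'(2)] reach_trans[OF assms(1) lm'(3) lm(3)]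
    unfolding hilbert_near_def by blast
qed

text \<open>
  The witness lies on the line through \<open>p\<close> and \<open>q\<close>, hence in every affine subspace that contains both points.
  A slice therefore carries the same closeness as the whole set, which is what makes induction on the dimension possible.
\<close>

lemma reach_slice:
  assumes "reach C l p q" "affine H" "p \<in> H" "q \<in> H \<inter> C"
  shows "reach (C \<inter> H) l p q"
proof -
  obtain c where c: "c \<in> C" "l *\<^sub>R q = p + (l - 1) *\<^sub>R c" "1 \<le> l"
    using assms unfolding reach_def by blast
  show ?thesis
  proof (cases "l = 1")
    case True
    then show ?thesis using c assms unfolding reach_def by auto
  next
    case False
    have "(l - 1) *\<^sub>R c = l *\<^sub>R q - p" using c(2) by simp
    then have "(1 / (l - 1)) *\<^sub>R ((l - 1) *\<^sub>R c) = (1 / (l - 1)) *\<^sub>R (l *\<^sub>R q - p)" by simp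
    then have "c = (l / (l - 1)) *\<^sub>R q + (- 1 / (l - 1)) *\<^sub>R p"
      using False by (simp add: scaleR_diff_right)
    moreover have "l / (l - 1) + (- 1 / (l - 1)) = 1"
      using False by (simp add: diff_divide_distrib[symmetric])
    ultimately have "c \<in> H"
      using assms unfolding affine_def by blast
    then show ?thesis using c unfolding reach_def by auto
  qed
qed

lemma hilbert_near_slice:
  assumes "hilbert_near C k p q" "affine H" "p \<in> H \<inter> C" "q \<in> H \<inter> C"
  shows "hilbert_near (C \<inter> H) k p q"
  using assms reach_slice[of C _ p q H] reach_slice[of C _ q p H] unfolding hilbert_near_def by blast

text \<open>
  At the dividing point \<open>q\<close> the function keeps at least the \<open>l\<close>-th part of its value at \<open>p\<close>, because the other end
  of the segment contributes a nonnegative amount.  Such functions are the tool for showing that points are far from each other.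
\<close>

lemma reach_functional:
  fixes a :: "'a::real_inner"
  assumes "reach C l p q" "\<And>c. c \<in> C \<Longrightarrow> b \<le> a \<bullet> c"
  shows "a \<bullet> p - b \<le> l * (a \<bullet> q - b)"
proof -
  obtain c where c: "c \<in> C" "l *\<^sub>R q = p + (l - 1) *\<^sub>R c" "1 \<le> l"
    using assms unfolding reach_def by blast
  have "l * (a \<bullet> q) = a \<bullet> (l *\<^sub>R q)" by simp
  also have "\<dots> = a \<bullet> p + (l - 1) * (a \<bullet> c)" unfolding c(2) by (simp add: inner_add_right)
  also have "\<dots> \<ge> a \<bullet> p + (l - 1) * b" using assms(2)[OF c(1)] c(3) by (simp add: mult_left_mono)
  finally show ?thesis by (simp add: algebra_simps)
qed

lemma hilbert_near_functional:
  fixes a :: "'a::real_inner"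
  assumes "hilbert_near C k p q" "\<And>c. c \<in> C \<Longrightarrow> b \<le> a \<bullet> c" "a \<bullet> q - b > 0"
  shows "a \<bullet> p - b \<le> k * (a \<bullet> q - b)"
proof -
  obtain l m where lm: "l * m \<le> k" "reach C l p q" "reach C m q p"
    using assms unfolding hilbert_near_def by blast
  have "l * 1 \<le> l * m"
    using reach_ge_1[OF lm(2)] reach_ge_1[OF lm(3)] by (intro mult_left_mono) auto
  then have "l \<le> k" using lm(1) by simp
  then have "l * (a \<bullet> q - b) \<le> k * (a \<bullet> q - b)" using assms(3) by (intro mult_right_mono) auto
  then show ?thesis using reach_functional[OF lm(2) assms(2)] by linarith
qed

text \<open>
  Going from \<open>p\<close> towards a point \<open>e\<close> of \<open>D\<close> until the remaining distance has shrunk by the factor \<open>t\<close> costs a ratio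
  \<open>1 / t\<close>.  By the next lemma the ratio for the way back stays bounded, provided that \<open>D\<close> extends beyond \<open>p\<close>, as seen from
  \<open>e\<close>.  Together they show that the Hilbert distance covered is \<open>ln (1 / t) / 2\<close> up to a constant.
\<close>

lemma reach_towards:
  assumes "e \<in> D" "0 < t" "t \<le> 1"
  shows "reach D (1 / t) p (e + t *\<^sub>R (p - e))"
proof -
  have "(1 / t) *\<^sub>R (e + t *\<^sub>R (p - e)) = p + (1 / t - 1) *\<^sub>R e"
    using assms by (simp add: algebra_simps)
  then show ?thesis using assms unfolding reach_def by auto
qed

lemma reach_back:
  assumes D: "convex D" and "p \<in> D" "0 \<le> t" "t \<le> 1" "0 < d" and c: "p + d *\<^sub>R (p - e) \<in> D"
  shows "reach D (1 + 1 / d) (e + t *\<^sub>R (p - e)) p"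
proof -
  have "reach D (1 + (1 - t) / d) (e + t *\<^sub>R (p - e)) p"
  proof -
    have "((1 - t) / d) *\<^sub>R (p + d *\<^sub>R (p - e)) = ((1 - t) / d) *\<^sub>R p + (1 - t) *\<^sub>R (p - e)"
      using \<open>0 < d\<close> by (simp add: scaleR_add_right)
    moreover have "(1 + k) *\<^sub>R p = (e + t *\<^sub>R (p - e)) + (k *\<^sub>R p + (1 - t) *\<^sub>R (p - e))" for k
      by (simp add: algebra_simps)
    ultimately have "(1 + (1 - t) / d) *\<^sub>R p = (e + t *\<^sub>R (p - e)) + ((1 + (1 - t) / d) - 1) *\<^sub>R (p + d *\<^sub>R (p - e))"
      unfolding add_diff_cancel_left' by simp
    then show ?thesis using assms unfolding reach_def by auto
  qed
  moreover have "1 + (1 - t) / d \<le> 1 + 1 / d" using assms by (simp add: divide_right_mono)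
  ultimately show ?thesis using reach_mono[OF D] \<open>p \<in> D\<close> by blast
qed

section \<open>Packings of convex sets of every dimension\<close>

text \<open>
  A hyperplane through a relative interior point that does not contain \<open>D\<close> cuts out a set of dimension one less, with that
  point still in its relative interior: an open piece of the affine hull of \<open>D\<close> is cut by the hyperplane.
\<close>

lemma slice_rel_interior:
  fixes D :: "'a::euclidean_space set"
  assumes D: "convex D" and q: "q \<in> rel_interior D" and e: "e \<in> D" "a \<bullet> e \<noteq> a \<bullet> q"
  shows "q \<in> rel_interior (D \<inter> {y. a \<bullet> y = a \<bullet> q})"
    and "aff_dim (D \<inter> {y. a \<bullet> y = a \<bullet> q}) = aff_dim D - 1"
proof -
  let ?H = "{y. a \<bullet> y = a \<bullet> q}"
  have "rel_interior (D \<inter> ?H) = rel_interior D \<inter> ?H"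
    using q by (intro convex_affine_rel_interior_Int[OF D affine_hyperplane]) auto
  then show "q \<in> rel_interior (D \<inter> ?H)" using q by auto
  obtain U where U: "open U" "rel_interior D = U \<inter> affine hull D"
    using openin_rel_interior[of D] unfolding openin_open by auto
  have aff: "affine (affine hull D \<inter> ?H)" by (intro affine_Int affine_affine_hull affine_hyperplane)
  have "q \<in> affine hull D" using U q by auto
  have "affine hull (affine hull D \<inter> ?H \<inter> U) = affine hull (affine hull D \<inter> ?H)"
    using U q by (intro affine_hull_affine_Int_open[OF aff U(1)]) auto
  moreover have "affine hull (affine hull D \<inter> ?H \<inter> U) \<subseteq> affine hull (D \<inter> ?H)"
    using U rel_interior_subset[of D] by (intro hull_mono) blast
  moreover have "affine hull (D \<inter> ?H) \<subseteq> affine hull (affine hull D \<inter> ?H)"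
    using hull_subset[of D affine] by (intro hull_mono) blast
  ultimately have "affine hull (D \<inter> ?H) = affine hull (affine hull D \<inter> ?H)"
    by (intro subset_antisym) (simp only:)+
  then have "aff_dim (D \<inter> ?H) = aff_dim (affine hull D \<inter> ?H)"
    by (rule aff_dim_affine_hull2)
  also have "\<dots> = aff_dim (affine hull D) - 1"
    using \<open>q \<in> affine hull D\<close> hull_inc[OF e(1), of affine] e(2)
    by (auto simp: aff_dim_affine_Int_hyperplane)
  finally show "aff_dim (D \<inter> ?H) = aff_dim D - 1" by simp
qed

lemma level_separation:
  fixes a :: "'a::real_inner"
  assumes "\<And>c. c \<in> D \<Longrightarrow> b \<le> a \<bullet> c" "a \<bullet> z - b > 0" "a \<bullet> y - b > k * (a \<bullet> z - b)"
  shows "\<not> hilbert_near D k y z"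
  using hilbert_near_functional[of D k y z b a] assms by fastforce

text \<open>
  Of the two ends of a chord through \<open>p\<close> take the nearer one: the reflection of \<open>e\<close> in \<open>p\<close> is then still on the chord.
  The cost of going back from \<open>e\<close> is thereby bounded independently of \<open>D\<close> and \<open>p\<close>, which keeps the constants of the
  packing lemma universal.
\<close>

lemma near_end_of_chord:
  fixes D :: "'a::euclidean_space set"
  assumes D: "convex D" "compact D" and p: "p \<in> rel_interior D" and dim: "aff_dim D > 0"
  obtains e where "e \<in> D" "e \<notin> rel_interior D" "p + (p - e) \<in> D"
proof -
  have "p \<in> D" using p rel_interior_subset by blast
  obtain q where q: "q \<in> D" "q \<noteq> p"
  proof (rule ccontr)
    assume "\<not> thesis"
    then have "D = {p}" using that \<open>p \<in> D\<close> by blast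
    then show False using dim by simp
  qed
  define v where "v = q - p"
  have v: "v \<noteq> 0" using q unfolding v_def by simp
  have fr: "rel_frontier D \<subseteq> D" using closure_closed[OF compact_imp_closed[OF D(2)]] unfolding rel_frontier_def by auto
  have "2 *\<^sub>R p + (-1) *\<^sub>R q \<in> affine hull D"
    using hull_subset[of D affine] \<open>p \<in> D\<close> q
    by (intro mem_affine[OF affine_affine_hull]) auto
  then have aff: "p + v \<in> affine hull D" "p + - v \<in> affine hull D"
    using hull_subset[of D affine] q by (auto simp: v_def algebra_simps scaleR_2)
  have bd: "bounded D" using D compact_imp_bounded by blast
  obtain d1 where d1: "0 < d1" "p + d1 *\<^sub>R v \<in> rel_frontier D"
    using ray_to_rel_frontier[OF bd p aff(1) v] by metis
  obtain d2 where d2: "0 < d2" "p + d2 *\<^sub>R (- v) \<in> rel_frontier D"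
    using ray_to_rel_frontier[OF bd p aff(2)] v by (metis neg_equal_0_iff_equal)
  have *: "\<exists>e. e \<in> D \<and> e \<notin> rel_interior D \<and> p + (p - e) \<in> D"
    if "0 < d1" "p + d1 *\<^sub>R v \<in> rel_frontier D" "p + d2 *\<^sub>R (- v) \<in> rel_frontier D" "d1 \<le> d2"
    for d1 d2 and v :: 'a
  proof (intro exI conjI)
    let ?e = "p + d1 *\<^sub>R v"
    show "?e \<in> D" "?e \<notin> rel_interior D" using that fr unfolding rel_frontier_def by auto
    have "(1 - d1 / d2) *\<^sub>R p + (d1 / d2) *\<^sub>R (p + d2 *\<^sub>R (- v)) \<in> D"
      using that fr \<open>p \<in> D\<close> by (intro convexD[OF D(1)]) auto
    moreover have "(d1 / d2) *\<^sub>R (p + d2 *\<^sub>R (- v)) = (d1 / d2) *\<^sub>R p - d1 *\<^sub>R v"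
      using that by (simp add: scaleR_add_right scaleR_diff_right)
    moreover have "(1 - k) *\<^sub>R p + (k *\<^sub>R p - d1 *\<^sub>R v) = p + (p - ?e)" for k
      by (simp add: algebra_simps)
    ultimately show "p + (p - ?e) \<in> D" by metis
  qed
  show ?thesis
  proof (cases "d1 \<le> d2")
    case True
    then show ?thesis using *[OF d1 d2(2)] that by blast
  next
    case False
    then show ?thesis using *[of d2 "- v" d1] d1 d2 that by auto
  qed
qed

text \<open>
  A finite set inside the ball of radius \<open>ln K / 2\<close> about \<open>p\<close> whose points have mutual Hilbert distance at least
  \<open>ln 16 / 2\<close>, expressed by closeness.  The number 16 is chosen so that the neighbourhoods used for measuring volume, all of
  whose points satisfy \<open>hilbert_near C 4\<close> with respect to their centre, are disjoint.
\<close>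

definition packing :: "'a::real_vector set \<Rightarrow> real \<Rightarrow> 'a \<Rightarrow> 'a set \<Rightarrow> bool" where
  "packing D K p S \<longleftrightarrow> finite S \<and> S \<subseteq> D \<and> (\<forall>y\<in>S. hilbert_near D K p y) \<and>
     pairwise (\<lambda>y z. \<not> hilbert_near D 16 y z) S"

lemma packingD:
  assumes "packing D K p S"
  shows "finite S" "S \<subseteq> D" "y \<in> S \<Longrightarrow> hilbert_near D K p y"
    and "y \<in> S \<Longrightarrow> z \<in> S \<Longrightarrow> y \<noteq> z \<Longrightarrow> \<not> hilbert_near D 16 y z"
  using assms unfolding packing_def pairwise_def by simp_all

lemma packingI:
  assumes "finite S" "S \<subseteq> D" "\<And>y. y \<in> S \<Longrightarrow> hilbert_near D K p y"
    and "\<And>y z. y \<in> S \<Longrightarrow> z \<in> S \<Longrightarrow> y \<noteq> z \<Longrightarrow> \<not> hilbert_near D 16 y z"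
  shows "packing D K p S"
  using assms unfolding packing_def pairwise_def by simp

lemma packing_mono:
  assumes "packing D K p S" "K \<le> K'"
  shows "packing D K' p S"
  using packingD[OF assms(1)] by (intro packingI) (auto intro: hilbert_near_mono[OF _ assms(2)])

lemma packing_slice:
  assumes S: "packing (D \<inter> H) K p S" and H: "affine H"
  shows "packing D K p S"
proof (rule packingI)
  fix y z assume yz: "y \<in> S" "z \<in> S" "y \<noteq> z"
  then have "y \<in> H \<inter> D" "z \<in> H \<inter> D" using packingD(2)[OF S] by auto
  then show "\<not> hilbert_near D 16 y z"
    using hilbert_near_slice[OF _ H] packingD(4)[OF S yz] by auto
qed (use packingD[OF S] hilbert_near_subset[of "D \<inter> H"] in auto)

lemma packing_shift:
  assumes "convex D" "hilbert_near D K p q" "packing D K' q S"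
  shows "packing D (K * K') p S"
  using packingD[OF assms(3)] hilbert_near_trans[OF assms(1,2)] by (intro packingI) simp_all

lemma packing_UN:
  assumes I: "finite I" and S: "\<And>i. i \<in> I \<Longrightarrow> packing D K p (S i)" "\<And>i. i \<in> I \<Longrightarrow> card (S i) = m"
    and sep: "\<And>i j y z. \<lbrakk>i \<in> I; j \<in> I; i \<noteq> j; y \<in> S i; z \<in> S j\<rbrakk> \<Longrightarrow> \<not> hilbert_near D 16 y z"
  shows "packing D K p (\<Union>i\<in>I. S i)" "card (\<Union>i\<in>I. S i) = card I * m"
proof -
  have disj: "S i \<inter> S j = {}" if "i \<in> I" "j \<in> I" "i \<noteq> j" for i j
  proof -
    have "x \<notin> S j" if "x \<in> S i" for x
    proof
      assume "x \<in> S j"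
      have "x \<in> D" using packingD(2)[OF S(1)[OF \<open>i \<in> I\<close>]] that by auto
      then have "hilbert_near D 16 x x" using hilbert_near_mono[OF hilbert_near_refl] by force
      then show False using sep \<open>i \<in> I\<close> \<open>j \<in> I\<close> \<open>i \<noteq> j\<close> that \<open>x \<in> S j\<close> by blast
    qed
    then show ?thesis by blast
  qed
  have "card (\<Union>i\<in>I. S i) = (\<Sum>i\<in>I. card (S i))"
    using I packingD(1)[OF S(1)] disj by (intro card_UN_disjoint) auto
  then show "card (\<Union>i\<in>I. S i) = card I * m" using S(2) by simp
  show "packing D K p (\<Union>i\<in>I. S i)"
  proof (rule packingI)
    show "finite (\<Union>i\<in>I. S i)" using I packingD(1)[OF S(1)] by simp
    show "(\<Union>i\<in>I. S i) \<subseteq> D" using packingD(2)[OF S(1)] by (intro UN_least) simp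
    show "hilbert_near D K p y" if "y \<in> (\<Union>i\<in>I. S i)" for y using that packingD(3)[OF S(1)] by auto
    fix y z assume "y \<in> (\<Union>i\<in>I. S i)" "z \<in> (\<Union>i\<in>I. S i)" "y \<noteq> z"
    then obtain i j where ij: "i \<in> I" "j \<in> I" "y \<in> S i" "z \<in> S j" by auto
    show "\<not> hilbert_near D 16 y z"
    proof (cases "i = j")
      case True
      then show ?thesis using packingD(4)[OF S(1)[OF ij(1)]] ij \<open>y \<noteq> z\<close> by simp
    next
      case False
      then show ?thesis using sep ij by simp
    qed
  qed
qed

lemma slice_point:
  fixes D :: "'a::euclidean_space set"
  assumes D: "convex D" "compact D" "p \<in> rel_interior D" and e: "e \<in> D" "a \<bullet> e < a \<bullet> p"
    and t: "0 < t" "t \<le> 1" and q: "q = e + t *\<^sub>R (p - e)"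
  defines "H \<equiv> {y. a \<bullet> y = a \<bullet> q}"
  shows "a \<bullet> q - a \<bullet> e = t * (a \<bullet> p - a \<bullet> e)"
    and "affine H" "convex (D \<inter> H)" "compact (D \<inter> H)" "q \<in> rel_interior (D \<inter> H)"
    and "aff_dim (D \<inter> H) = aff_dim D - 1"
proof -
  show aq: "a \<bullet> q - a \<bullet> e = t * (a \<bullet> p - a \<bullet> e)"
    unfolding q by (simp add: inner_add_right inner_diff_right)
  show aff: "affine H" unfolding H_def by (rule affine_hyperplane)
  show "convex (D \<inter> H)" using D(1) aff by (simp add: convex_Int affine_imp_convex)
  show "compact (D \<inter> H)"
    unfolding H_def using D(2) closed_hyperplane by (intro compact_Int_closed) auto
  have "e - t *\<^sub>R (e - p) \<in> rel_interior D"
    by (rule rel_interior_convex_shrink[OF D(1,3) e(1) t])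
  then have qi: "q \<in> rel_interior D" unfolding q by (simp add: algebra_simps)
  have "0 < t * (a \<bullet> p - a \<bullet> e)" using t e by simp
  then have "a \<bullet> e \<noteq> a \<bullet> q" using aq by linarith
  then show "q \<in> rel_interior (D \<inter> H)" "aff_dim (D \<inter> H) = aff_dim D - 1"
    unfolding H_def using slice_rel_interior[OF D(1) qi e(1)] by blast+
qed

text \<open>
  Balls of radius of order \<open>N\<close> in a convex set of dimension \<open>k\<close> contain at least \<open>N ^ k\<close> separated points, with constants that
  depend neither on the set nor on the centre.  Walk from the centre towards a nearby boundary point \<open>e\<close>, and at each of the
  \<open>N\<close> levels \<open>32 ^ (- s)\<close> of a supporting function at \<open>e\<close> use \<open>N ^ (k - 1)\<close> points of the slice parallel to the supporting
  hyperplane.  Points of one slice are separated by induction, points of different slices by the supporting function.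
\<close>

theorem polynomial_packing:
  fixes D :: "'a::euclidean_space set"
  assumes "convex D" "compact D" "p \<in> rel_interior D" "aff_dim D = int k"
  shows "\<exists>S. packing D (32 ^ (k * N)) p S \<and> card S = N ^ k"
  using assms
proof (induction k arbitrary: D p)
  case 0
  then have "p \<in> D" using rel_interior_subset by blast
  then show ?case using hilbert_near_refl[of p D] by (intro exI[of _ "{p}"]) (auto simp: packing_def)
next
  case (Suc k)
  have pD: "p \<in> D" using Suc.prems rel_interior_subset by blast
  obtain e where e: "e \<in> D" "e \<notin> rel_interior D" "p + (p - e) \<in> D"
    using near_end_of_chord[OF Suc.prems(1-3)] Suc.prems(4) by auto
  obtain a where a: "\<And>y. y \<in> D \<Longrightarrow> a \<bullet> e \<le> a \<bullet> y" "\<And>y. y \<in> rel_interior D \<Longrightarrow> a \<bullet> e < a \<bullet> y"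
    using supporting_hyperplane_rel_boundary[OF Suc.prems(1) e(1,2)] by metis
  have ap: "a \<bullet> e < a \<bullet> p" using a(2) Suc.prems(3) by blast
  define q where "q s = e + ((1 / 32) ^ s) *\<^sub>R (p - e)" for s :: nat
  have t: "0 < (1 / 32 :: real) ^ s" "(1 / 32 :: real) ^ s \<le> 1" for s by (auto simp: power_le_one)
  note sl = slice_point[OF Suc.prems(1-3) e(1) ap t q_def]
  have "\<exists>S. packing (D \<inter> {y. a \<bullet> y = a \<bullet> q s}) (32 ^ (k * N)) (q s) S \<and> card S = N ^ k" for s
    using sl(6)[of s] Suc.prems(4) by (intro Suc.IH[OF sl(3,4,5)]) simp
  then obtain S where S: "\<And>s. packing (D \<inter> {y. a \<bullet> y = a \<bullet> q s}) (32 ^ (k * N)) (q s) (S s)"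
      "\<And>s. card (S s) = N ^ k"
    by metis
  have level: "a \<bullet> y - a \<bullet> e = (1 / 32) ^ s * (a \<bullet> p - a \<bullet> e)" if "y \<in> S s" for y s
  proof -
    have "a \<bullet> y = a \<bullet> q s" using that packingD(2)[OF S(1)[of s]] by auto
    then show ?thesis using sl(1)[of s] by simp
  qed
  have sep: "\<not> hilbert_near D 16 y z" if "y \<in> S s" "z \<in> S t" "s < t" for y z s t
  proof -
    have "(1 / 32 :: real) ^ t \<le> (1 / 32) ^ Suc s"
      using \<open>s < t\<close> by (intro power_decreasing) auto
    then have "(1 / 32) ^ t * (a \<bullet> p - a \<bullet> e) \<le> (1 / 32) ^ Suc s * (a \<bullet> p - a \<bullet> e)"
      using ap by (intro mult_right_mono) auto
    moreover have "(1 / 32) ^ s * (a \<bullet> p - a \<bullet> e) > 0" using ap by simp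
    ultimately have "16 * (a \<bullet> z - a \<bullet> e) < a \<bullet> y - a \<bullet> e"
      unfolding level[OF that(1)] level[OF that(2)] by simp
    moreover have "0 < a \<bullet> z - a \<bullet> e" unfolding level[OF that(2)] using ap by simp
    ultimately show ?thesis using a(1) by (intro level_separation[where b = "a \<bullet> e"]) auto
  qed
  have pk: "packing D (32 ^ (Suc k * N)) p (S s)" if "s < N" for s
  proof -
    \<comment> \<open>the factor 2 of the way back is absorbed by one more level\<close>
    have "reach D (32 ^ s) p (q s)" "reach D 2 (q s) p"
      using reach_towards[OF e(1) t[of s], of p] e(3)
        reach_back[OF Suc.prems(1) pD less_imp_le[OF t(1)] t(2), of 1 e s]
      unfolding q_def by (simp_all add: power_one_over)
    then have "hilbert_near D (2 * 32 ^ s) p (q s)"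
      by (rule hilbert_nearI) simp
    moreover have "2 * 32 ^ s \<le> (32 :: real) ^ N"
      using power_increasing[of "Suc s" N "32::real"] that zero_less_power[of "32::real" s]
      unfolding power_Suc by linarith
    ultimately have "hilbert_near D (32 ^ N) p (q s)" by (rule hilbert_near_mono)
    then have "packing D (32 ^ N * 32 ^ (k * N)) p (S s)"
      by (rule packing_shift[OF Suc.prems(1) _ packing_slice[OF S(1) sl(2)]])
    then show ?thesis by (simp add: power_add)
  qed
  have sep': "\<not> hilbert_near D 16 y z" if "s \<noteq> t" "y \<in> S s" "z \<in> S t" for s t y z
  proof (cases "s < t")
    case True
    then show ?thesis by (rule sep[OF that(2,3)])
  next
    case False
    then have "t < s" using that(1) by simp
    then show ?thesis using sep[OF that(3,2)] hilbert_near_sym[of D 16 y z] by blast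
  qed
  have 1: "packing D (32 ^ (Suc k * N)) p (S s)" if "s \<in> {..<N}" for s using that pk by simp
  have 2: "card (S s) = N ^ k" if "s \<in> {..<N}" for s using S(2) by simp
  have 3: "\<not> hilbert_near D 16 y z" if "s \<in> {..<N}" "t \<in> {..<N}" "s \<noteq> t" "y \<in> S s" "z \<in> S t" for s t y z
    using that by (intro sep')
  note UN = packing_UN[OF finite_lessThan 1 2 3]
  have "card (\<Union>s\<in>{..<N}. S s) = N ^ Suc k" using UN(2) by simp
  then show ?case using UN(1) by (intro exI conjI)
qed

section \<open>The Hilbert and Finsler metrics in terms of closeness\<close>

lemma hilbert_geometryD:
  assumes "hilbert_geometry C"
  shows "open C" "convex C" "C \<noteq> {}"
  using assms unfolding hilbert_geometry_def by blast+

lemma ray_meets_frontier: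
  assumes C: "hilbert_geometry C" and p: "p \<in> C" and s: "0 < s" "p + s *\<^sub>R v \<notin> C"
  obtains t where "0 < t" "t \<le> s" "p + t *\<^sub>R v \<in> frontier C"
proof -
  have "closed_segment p (p + s *\<^sub>R v) \<inter> frontier C \<noteq> {}"
    using p s by (intro connected_Int_frontier) auto
  then obtain u where u: "0 \<le> u" "u \<le> 1" "(1 - u) *\<^sub>R p + u *\<^sub>R (p + s *\<^sub>R v) \<in> frontier C"
    unfolding in_segment by (auto simp: closed_segment_def)
  have fr: "p + (u * s) *\<^sub>R v \<in> frontier C" using u(3) by (simp add: algebra_simps)
  have "p \<notin> frontier C"
    using p hilbert_geometryD(1)[OF C] by (simp add: frontier_def interior_open)
  then have "u \<noteq> 0" using fr by auto
  then show ?thesis using that[OF _ _ fr] u s by (simp add: mult_left_le_one_le)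
qed

lemma beyond_frontier_not_mem:
  assumes C: "hilbert_geometry C" and p: "p \<in> C" and t: "0 < t" "p + t *\<^sub>R v \<in> frontier C" "t \<le> s"
  shows "p + s *\<^sub>R v \<notin> C"
proof
  assume "p + s *\<^sub>R v \<in> C"
  then have "(1 - t / s) *\<^sub>R p + (t / s) *\<^sub>R (p + s *\<^sub>R v) \<in> C"
    using t p hilbert_geometryD(2)[OF C] by (intro convexD) auto
  moreover have "(1 - t / s) *\<^sub>R p + (t / s) *\<^sub>R (p + s *\<^sub>R v) = p + t *\<^sub>R v"
    using t by (simp add: algebra_simps)
  ultimately show False
    using t hilbert_geometryD(1)[OF C] by (simp add: frontier_def interior_open)
qed

lemma inverse_exit_time_nonneg:
  assumes C: "hilbert_geometry C" "p \<in> C"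
  shows "0 \<le> inverse_exit_time C p v"
proof (cases "\<exists>t>0. p + t *\<^sub>R v \<in> frontier C")
  case True
  then obtain t where t: "t > 0" "p + t *\<^sub>R v \<in> frontier C" by blast
  have "v \<noteq> 0"
    using t C hilbert_geometryD(1)[OF C(1)] by (auto simp: frontier_def interior_open)
  then have "(THE t. t > 0 \<and> p + t *\<^sub>R v \<in> frontier C) = t"
    using t exit_time_unique[OF C] by (intro the_equality) blast+
  then show ?thesis using t unfolding inverse_exit_time_def by auto
next
  case False
  then show ?thesis unfolding inverse_exit_time_def by (simp only: if_False order_refl)
qed

text \<open>
  The inverse exit time is the Minkowski gauge of \<open>C - p\<close>; this form of the statement treats rays that never leave \<open>C\<close> and
  the zero vector on the same footing as the others.
\<close>

lemma inverse_exit_time_less_iff: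
  assumes C: "hilbert_geometry C" "p \<in> C" and s: "s > 0"
  shows "inverse_exit_time C p v < s \<longleftrightarrow> p + (1 / s) *\<^sub>R v \<in> C"
proof (cases "\<exists>t>0. p + t *\<^sub>R v \<in> frontier C")
  case True
  then obtain t where t: "t > 0" "p + t *\<^sub>R v \<in> frontier C" by blast
  have v: "v \<noteq> 0"
    using t C hilbert_geometryD(1)[OF C(1)] by (auto simp: frontier_def interior_open)
  then have "(THE t. t > 0 \<and> p + t *\<^sub>R v \<in> frontier C) = t"
    using t exit_time_unique[OF C] by (intro the_equality) blast+
  then have "inverse_exit_time C p v = 1 / t" using t unfolding inverse_exit_time_def by auto
  moreover have "1 / t < s \<longleftrightarrow> 1 / s < t" using t s by (simp add: field_simps)
  moreover have "1 / s < t \<longleftrightarrow> p + (1 / s) *\<^sub>R v \<in> C"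
  proof
    assume *: "1 / s < t"
    show "p + (1 / s) *\<^sub>R v \<in> C"
    proof (rule ccontr)
      assume "p + (1 / s) *\<^sub>R v \<notin> C"
      then obtain t' where "0 < t'" "t' \<le> 1 / s" "p + t' *\<^sub>R v \<in> frontier C"
        using ray_meets_frontier[OF C, of "1 / s" v] s by auto
      then show False using exit_time_unique[OF C v t] * by force
    qed
  next
    assume "p + (1 / s) *\<^sub>R v \<in> C"
    then show "1 / s < t" using beyond_frontier_not_mem[OF C t, of "1 / s"] by force
  qed
  ultimately show ?thesis by simp
next
  case False
  then have "p + (1 / s) *\<^sub>R v \<in> C"
    using ray_meets_frontier[OF C, of "1 / s" v] s by force
  moreover have "inverse_exit_time C p v = 0" using False unfolding inverse_exit_time_def by auto
  ultimately show ?thesis using s by simp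
qed

text \<open>
  The largest subset of \<open>C - p\<close> that is symmetric about the origin.  The Finsler norm averages the gauges of \<open>C - p\<close> and
  \<open>p - C\<close>, whereas the gauge of this body is their maximum, so its volume is comparable to that of the Finsler ball and it is
  easier to handle.
\<close>

definition sym_body :: "'a::real_vector set \<Rightarrow> 'a \<Rightarrow> 'a set" where
  "sym_body C p = {v. p + v \<in> C \<and> p - v \<in> C}"

lemma finsler_less_1_iff:
  assumes C: "hilbert_geometry C" "p \<in> C"
  shows "finsler C p v < 1 \<longleftrightarrow> inverse_exit_time C p v + inverse_exit_time C p (- v) < 2"
proof (cases "v = 0")
  case True
  then have "inverse_exit_time C p v < 1" "inverse_exit_time C p (- v) < 1"
    using inverse_exit_time_less_iff[OF C, of 1] C by auto
  then show ?thesis using True by (simp add: finsler_def)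
qed (simp add: finsler_def)

lemma sym_body_subset_finsler_ball:
  assumes C: "hilbert_geometry C" "p \<in> C"
  shows "sym_body C p \<subseteq> finsler_ball C p"
proof
  fix v assume "v \<in> sym_body C p"
  then have "inverse_exit_time C p v < 1" "inverse_exit_time C p (- v) < 1"
    using inverse_exit_time_less_iff[OF C, of 1] unfolding sym_body_def by auto
  then show "v \<in> finsler_ball C p"
    using finsler_less_1_iff[OF C, of v] unfolding finsler_ball_def by simp
qed

lemma finsler_ball_subset_sym_body:
  assumes C: "hilbert_geometry C" "p \<in> C"
  shows "finsler_ball C p \<subseteq> (\<lambda>v. 2 *\<^sub>R v) ` sym_body C p"
proof
  fix v assume "v \<in> finsler_ball C p"
  then have "inverse_exit_time C p v < 2" "inverse_exit_time C p (- v) < 2"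
    using finsler_less_1_iff[OF C, of v] inverse_exit_time_nonneg[OF C, of v]
      inverse_exit_time_nonneg[OF C, of "- v"] unfolding finsler_ball_def by auto
  then have "(1 / 2) *\<^sub>R v \<in> sym_body C p"
    using inverse_exit_time_less_iff[OF C, of 2] unfolding sym_body_def by auto
  then show "v \<in> (\<lambda>v. 2 *\<^sub>R v) ` sym_body C p"
    by (intro image_eqI[of _ _ "(1 / 2) *\<^sub>R v"]) auto
qed

lemma open_sym_body:
  fixes C :: "'a::real_normed_vector set"
  assumes "open C" shows "open (sym_body C p)"
proof -
  have "sym_body C p = (\<lambda>v. p + v) -` C \<inter> (\<lambda>v. p - v) -` C" unfolding sym_body_def by auto
  then show ?thesis using assms by (auto intro!: open_Int open_vimage continuous_intros)
qed

text \<open>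
  Only openness is at stake: it makes the Lebesgue measure of the Finsler ball monotone in comparisons.  The bound 2 on
  the sum of the two gauges is split as \<open>s + (2 - s)\<close>.
\<close>

lemma open_finsler_ball:
  assumes C: "hilbert_geometry C" "p \<in> C"
  shows "open (finsler_ball C p)"
proof -
  have "finsler_ball C p = (\<Union>s\<in>{0<..<2}. {v. p + (1 / s) *\<^sub>R v \<in> C} \<inter> {v. p + (1 / (2 - s)) *\<^sub>R (- v) \<in> C})"
    (is "_ = ?U")
  proof
    show "finsler_ball C p \<subseteq> ?U"
    proof
      fix v assume "v \<in> finsler_ball C p"
      then have *: "inverse_exit_time C p v + inverse_exit_time C p (- v) < 2"
        using finsler_less_1_iff[OF C] unfolding finsler_ball_def by auto
      define d where "d = (2 - inverse_exit_time C p v - inverse_exit_time C p (- v)) / 2"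
      define s where "s = inverse_exit_time C p v + d"
      have "d > 0" using * unfolding d_def by simp
      have s: "inverse_exit_time C p v < s" "inverse_exit_time C p (- v) < 2 - s"
        using * unfolding s_def d_def by (auto simp: field_simps)
      then have "0 < s" "s < 2"
        using inverse_exit_time_nonneg[OF C, of v] inverse_exit_time_nonneg[OF C, of "- v"] by linarith+
      then show "v \<in> ?U"
        using s inverse_exit_time_less_iff[OF C, of s v] inverse_exit_time_less_iff[OF C, of "2 - s" "- v"]
        by auto
    qed
    show "?U \<subseteq> finsler_ball C p"
    proof
      fix v assume "v \<in> ?U"
      then obtain s where "0 < s" "s < 2" "p + (1 / s) *\<^sub>R v \<in> C" "p + (1 / (2 - s)) *\<^sub>R (- v) \<in> C" by auto
      then show "v \<in> finsler_ball C p"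
        using finsler_less_1_iff[OF C] inverse_exit_time_less_iff[OF C, of s v]
          inverse_exit_time_less_iff[OF C, of "2 - s" "- v"] unfolding finsler_ball_def by auto
    qed
  qed
  moreover have "open {v. p + r *\<^sub>R v \<in> C}" for r
  proof -
    have "continuous_on UNIV (\<lambda>v. p + r *\<^sub>R v)" by (intro continuous_intros)
    then show ?thesis using open_vimage[OF hilbert_geometryD(1)[OF C(1)]] unfolding vimage_def by blast
  qed
  moreover from this[of "- r" for r] have "open {v. p + r *\<^sub>R (- v) \<in> C}" for r by simp
  ultimately show ?thesis by (auto intro!: open_UN open_Int)
qed

text \<open>
  The two branches of the definition: the ray from \<open>p\<close> through \<open>q\<close> has \<open>q\<close> at the fraction \<open>u\<close> of its way to the
  boundary, or it stays in \<open>C\<close>.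
\<close>

lemma hilbert_ratio_cases:
  assumes C: "hilbert_geometry C" "p \<in> C" "q \<in> C" "p \<noteq> q"
  obtains (exit) u where "0 < u" "u < 1" "p + (1 / u) *\<^sub>R (q - p) \<in> frontier C"
      "hilbert_ratio C p q = 1 / (1 - u)"
    | (no_exit) "\<And>t. 0 \<le> t \<Longrightarrow> p + t *\<^sub>R (q - p) \<in> C" "hilbert_ratio C p q = 1"
proof (cases "\<exists>b. boundary_beyond C p q b")
  case True
  then obtain b where b: "boundary_beyond C p q b" ..
  have "(THE b. boundary_beyond C p q b) = b"
    using b boundary_beyond_unique[OF C(1,2) _ b] by (intro the_equality)
  then have r: "hilbert_ratio C p q = norm (p - b) / norm (q - b)"
    using True unfolding hilbert_ratio_def by simp
  obtain u where u: "0 < u" "u < 1" "q = (1 - u) *\<^sub>R p + u *\<^sub>R b" "p \<noteq> b"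
    using b unfolding boundary_beyond_def in_segment by blast
  have "q - p = u *\<^sub>R (b - p)" using u by (simp add: algebra_simps)
  then have "p + (1 / u) *\<^sub>R (q - p) = b" using u by simp
  moreover have "q - b = (1 - u) *\<^sub>R (p - b)" using u by (simp add: algebra_simps)
  then have "norm (q - b) = (1 - u) * norm (p - b)" using u by simp
  then have "hilbert_ratio C p q = 1 / (1 - u)" using r u by simp
  moreover have "b \<in> frontier C" using b unfolding boundary_beyond_def by blast
  ultimately show ?thesis using exit[OF u(1,2)] by simp
next
  case False
  have "p + t *\<^sub>R (q - p) \<in> C" if "0 \<le> t" for t
  proof (rule ccontr)
    assume *: "p + t *\<^sub>R (q - p) \<notin> C"
    then have "t \<noteq> 0" using C by auto
    then have "0 < t" using that by simp
    then obtain s where s: "0 < s" "p + s *\<^sub>R (q - p) \<in> frontier C"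
      using ray_meets_frontier[OF C(1,2) _ *] by metis
    have "1 < s" using beyond_frontier_not_mem[OF C(1,2) s, of 1] C(3) by (cases "s \<le> 1") auto
    have "q = (1 - 1 / s) *\<^sub>R p + (1 / s) *\<^sub>R (p + s *\<^sub>R (q - p))"
      using s by (simp add: algebra_simps)
    then have "q \<in> open_segment p (p + s *\<^sub>R (q - p))"
      unfolding in_segment using s \<open>1 < s\<close> C(4) by (intro conjI exI[of _ "1 / s"]) auto
    then show False using False s unfolding boundary_beyond_def by blast
  qed
  moreover have "hilbert_ratio C p q = 1" using False unfolding hilbert_ratio_def by (simp only: if_False)
  ultimately show ?thesis by (rule no_exit)
qed

lemma hilbert_ratio_ge_1:
  assumes "hilbert_geometry C" "p \<in> C" "q \<in> C" "p \<noteq> q"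
  shows "1 \<le> hilbert_ratio C p q"
  using assms by (cases rule: hilbert_ratio_cases) auto

lemma hilbert_ratio_le:
  assumes C: "hilbert_geometry C" "p \<in> C" "q \<in> C" "p \<noteq> q" and l: "reach C l p q"
  shows "hilbert_ratio C p q \<le> l"
  using C
proof (cases rule: hilbert_ratio_cases)
  case (exit u)
  obtain c where c: "c \<in> C" "l *\<^sub>R q = p + (l - 1) *\<^sub>R c" "1 \<le> l" using l unfolding reach_def by blast
  have "l \<noteq> 1" using c C(4) by auto
  then have l1: "l > 1" using c by simp
  have "(l - 1) *\<^sub>R c = (l - 1) *\<^sub>R p + l *\<^sub>R (q - p)" using c(2) by (simp add: algebra_simps)
  then have "(1 / (l - 1)) *\<^sub>R ((l - 1) *\<^sub>R c) = (1 / (l - 1)) *\<^sub>R ((l - 1) *\<^sub>R p + l *\<^sub>R (q - p))" by simp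
  then have "c = p + (l / (l - 1)) *\<^sub>R (q - p)" using l1 by (simp add: scaleR_add_right)
  then have "\<not> 1 / u \<le> l / (l - 1)"
    using beyond_frontier_not_mem[OF C(1,2) _ exit(3), of "l / (l - 1)"] exit(1) c(1) by auto
  then have "l / (l - 1) < 1 / u" by simp
  then have "1 / (1 - u) \<le> l" using exit(1,2) l1 by (simp add: field_simps)
  then show ?thesis using exit by simp
qed (use reach_ge_1[OF l] in simp)

text \<open>
  Such a function is nonnegative at the exit point, by continuity; along a ray that stays in \<open>C\<close> it cannot decrease.
\<close>

lemma hilbert_ratio_functional:
  assumes C: "hilbert_geometry C" "p \<in> C" "q \<in> C" "p \<noteq> q" and a: "\<And>c. c \<in> C \<Longrightarrow> b \<le> a \<bullet> c"
  shows "a \<bullet> p - b \<le> hilbert_ratio C p q * (a \<bullet> q - b)"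
  using C
proof (cases rule: hilbert_ratio_cases)
  case (exit u)
  have "C \<subseteq> {c. b \<le> a \<bullet> c}" using a by blast
  then have "closure C \<subseteq> {c. b \<le> a \<bullet> c}" by (intro closure_minimal closed_halfspace_ge)
  then have "b \<le> a \<bullet> (p + (1 / u) *\<^sub>R (q - p))" using exit(3) unfolding frontier_def by blast
  then have "u * b \<le> u * (a \<bullet> p + (a \<bullet> q - a \<bullet> p) / u)"
    using exit by (simp add: inner_add_right inner_diff_right)
  then have "(1 - u) * (a \<bullet> p - b) \<le> a \<bullet> q - b"
    using exit(1) by (simp add: distrib_left) (simp add: algebra_simps)
  then have "a \<bullet> p - b \<le> (a \<bullet> q - b) / (1 - u)"
    using exit(2) by (simp add: pos_le_divide_eq mult.commute)
  then show ?thesis unfolding exit(4) by simp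
next
  case no_exit
  have "a \<bullet> p \<le> a \<bullet> q"
  proof (rule ccontr)
    assume "\<not> a \<bullet> p \<le> a \<bullet> q"
    then have neg: "a \<bullet> p - a \<bullet> q > 0" by simp
    define t where "t = (\<bar>a \<bullet> p - b\<bar> + 1) / (a \<bullet> p - a \<bullet> q)"
    have "0 \<le> t" unfolding t_def using neg by simp
    then have "b \<le> a \<bullet> (p + t *\<^sub>R (q - p))" using no_exit a by blast
    also have "\<dots> = a \<bullet> p - t * (a \<bullet> p - a \<bullet> q)" by (simp add: inner_add_right inner_diff_right algebra_simps)
    also have "\<dots> = a \<bullet> p - (\<bar>a \<bullet> p - b\<bar> + 1)" unfolding t_def using neg by simp
    finally show False by linarith
  qed
  then show ?thesis using no_exit by simp
qed

lemma hilbert_dist_le: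
  assumes C: "hilbert_geometry C" "p \<in> C" "q \<in> C" and k: "hilbert_near C k p q" "1 \<le> k"
  shows "hilbert_dist C p q \<le> 1/2 * ln k"
proof (cases "p = q")
  case False
  obtain l m where lm: "l * m \<le> k" "reach C l p q" "reach C m q p" using k unfolding hilbert_near_def by blast
  have ge: "1 \<le> hilbert_ratio C p q" "1 \<le> hilbert_ratio C q p"
    using hilbert_ratio_ge_1 C False by metis+
  have "hilbert_ratio C q p * hilbert_ratio C p q \<le> m * l"
    using hilbert_ratio_le[OF C False lm(2)] hilbert_ratio_le[OF C(1,3,2) _ lm(3)] False ge
      reach_ge_1[OF lm(3)] by (intro mult_mono) auto
  then have "hilbert_ratio C q p * hilbert_ratio C p q \<le> k" using lm(1) by (simp add: mult.commute)
  moreover have "0 < hilbert_ratio C q p * hilbert_ratio C p q" using ge by simp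
  ultimately show ?thesis using False unfolding hilbert_dist_def by simp
qed (use k in \<open>simp add: hilbert_dist_def\<close>)

lemma hilbert_dist_functional:
  assumes C: "hilbert_geometry C" "p \<in> C" "q \<in> C" and r: "hilbert_dist C p q < r"
    and a: "\<And>c. c \<in> C \<Longrightarrow> b < a \<bullet> c"
  shows "a \<bullet> p - b \<le> exp (2 * r) * (a \<bullet> q - b)" "a \<bullet> q - b \<le> exp (2 * r) * (a \<bullet> p - b)"
proof -
  have pos: "a \<bullet> p - b > 0" "a \<bullet> q - b > 0" using a[OF C(2)] a[OF C(3)] by auto
  have a': "\<And>c. c \<in> C \<Longrightarrow> b \<le> a \<bullet> c" using a less_imp_le by blast
  have "a \<bullet> p - b \<le> exp (2 * r) * (a \<bullet> q - b) \<and> a \<bullet> q - b \<le> exp (2 * r) * (a \<bullet> p - b)"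
  proof (cases "p = q")
    case True
    then have "1 \<le> exp (2 * r)" using r by (simp add: hilbert_dist_def)
    then show ?thesis using True pos by simp
  next
    case False
    define R where "R = hilbert_ratio C p q"
    define R' where "R' = hilbert_ratio C q p"
    have ge: "1 \<le> R" "1 \<le> R'"
      using hilbert_ratio_ge_1 C False unfolding R_def R'_def by metis+
    have "ln (R' * R) < 2 * r" using r False unfolding hilbert_dist_def R_def R'_def by simp
    then have "exp (ln (R' * R)) < exp (2 * r)" by (simp only: exp_less_cancel_iff)
    moreover have "0 < R' * R" using ge by simp
    ultimately have "R' * R < exp (2 * r)" by simp
    moreover have "1 * R \<le> R' * R" "R' * 1 \<le> R' * R"
      using ge by simp_all
    ultimately have le: "R \<le> exp (2 * r)" "R' \<le> exp (2 * r)" by auto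
    have "a \<bullet> p - b \<le> R * (a \<bullet> q - b)" "a \<bullet> q - b \<le> R' * (a \<bullet> p - b)"
      using hilbert_ratio_functional[OF C False a'] hilbert_ratio_functional[OF C(1,3,2) False[symmetric] a']
      unfolding R_def R'_def by blast+
    moreover have "R * (a \<bullet> q - b) \<le> exp (2 * r) * (a \<bullet> q - b)" "R' * (a \<bullet> p - b) \<le> exp (2 * r) * (a \<bullet> p - b)"
      using le pos by simp_all
    ultimately show ?thesis by linarith
  qed
  then show "a \<bullet> p - b \<le> exp (2 * r) * (a \<bullet> q - b)" "a \<bullet> q - b \<le> exp (2 * r) * (a \<bullet> p - b)" by auto
qed

section \<open>Volume bounded below by packings\<close>

text \<open>
  The affine functions that are nonnegative on \<open>C\<close> form a convex cone.  If it had empty interior, it would lie in a hyperplane,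
  and the normal vector of the hyperplane would give a direction in which \<open>C\<close> is invariant, that is, a line in \<open>C\<close>.  A function
  in the interior of the cone can be perturbed by every small linear form and so dominates the norm.
\<close>

lemma convex_line_free_dominating_functional:
  fixes C :: "'a::euclidean_space set"
  assumes C: "open C" "convex C" "C \<noteq> {}"
    and line_free: "\<not> (\<exists>p v. v \<noteq> 0 \<and> range (\<lambda>t::real. p + t *\<^sub>R v) \<subseteq> C)"
  obtains a b where "\<And>y. y \<in> C \<Longrightarrow> norm y + 1 \<le> a \<bullet> y + b"
proof -
  \<comment> \<open>the affine functions nonnegative on \<open>C\<close>\<close>
  define S where "S = {f :: 'a \<times> real. \<forall>y\<in>C. 0 \<le> fst f \<bullet> y + snd f}"
  have "convex S"
  proof (rule convexI)
    fix f g and u v :: real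
    assume fg: "f \<in> S" "g \<in> S" and uv: "0 \<le> u" "0 \<le> v"
    have "0 \<le> fst (u *\<^sub>R f + v *\<^sub>R g) \<bullet> y + snd (u *\<^sub>R f + v *\<^sub>R g)" if "y \<in> C" for y
    proof -
      have "0 \<le> u * (fst f \<bullet> y + snd f) + v * (fst g \<bullet> y + snd g)"
        using fg uv that unfolding S_def by simp
      then show ?thesis by (simp add: inner_add_left algebra_simps)
    qed
    then show "u *\<^sub>R f + v *\<^sub>R g \<in> S" unfolding S_def by simp
  qed
  have "interior S \<noteq> {}"
  proof
    assume "interior S = {}"
    then obtain f c where f: "f \<noteq> 0" "S \<subseteq> {g. f \<bullet> g = c}"
      using empty_interior_subset_hyperplane[OF \<open>convex S\<close>] by blast
    have "(0, 0) \<in> S" "(0, 1) \<in> S" unfolding S_def by auto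
    then have "f \<bullet> (0, 0) = c" "f \<bullet> (0, 1) = c" using f(2) by blast+
    then have c: "c = 0" "snd f = 0" by (auto simp: inner_prod_def)
    obtain v where v: "f = (v, 0)" using c by (metis prod.collapse)
    then have "v \<noteq> 0" using f(1) by (auto simp: zero_prod_def)
    obtain p where p: "p \<in> C" using C by blast
    have "p + t *\<^sub>R v \<in> C" for t :: real
    proof (rule ccontr)
      assume "p + t *\<^sub>R v \<notin> C"
      then have disj: "{p + t *\<^sub>R v} \<inter> C = {}" by simp
      have "\<exists>a s. a \<noteq> 0 \<and> (\<forall>x\<in>{p + t *\<^sub>R v}. a \<bullet> x \<le> s) \<and> (\<forall>x\<in>C. s \<le> a \<bullet> x)"
        by (rule separating_hyperplane_sets[OF convex_singleton C(2) _ C(3) disj]) simp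
      then obtain a s where a: "a \<noteq> 0" "a \<bullet> (p + t *\<^sub>R v) \<le> s" "\<And>y. y \<in> C \<Longrightarrow> s \<le> a \<bullet> y"
        by auto
      have le: "a \<bullet> (p + t *\<^sub>R v) \<le> a \<bullet> y" if "y \<in> C" for y
        using a(2) a(3)[OF that] by linarith
      then have "(a, - (a \<bullet> (p + t *\<^sub>R v))) \<in> S" unfolding S_def by auto
      then have "v \<bullet> a = 0" using f(2) v c by (auto simp: inner_prod_def)
      then have min: "a \<bullet> p \<le> a \<bullet> y" if "y \<in> C" for y
        using le[OF that] by (simp add: inner_add_right inner_commute)
      obtain e where e: "e > 0" "ball p e \<subseteq> C" using C(1) p open_contains_ball by blast
      have "p - (e / 2 / norm a) *\<^sub>R a \<in> C"
        using e a(1) by (intro subsetD[OF e(2)]) (simp add: dist_norm)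
      then have "a \<bullet> p \<le> a \<bullet> p - (e / 2 / norm a) * (a \<bullet> a)"
        using min by (metis inner_diff_right inner_scaleR_right)
      moreover have "(e / 2 / norm a) * (a \<bullet> a) > 0" using e a(1) by simp
      ultimately show False by linarith
    qed
    then show False using line_free \<open>v \<noteq> 0\<close> by blast
  qed
  then obtain g d where g: "d > 0" "cball g d \<subseteq> S"
    by (meson ex_in_conv mem_interior_cball)
  obtain a0 b0 where ab: "g = (a0, b0)" by (cases g)
  have 1: "d * norm y \<le> a0 \<bullet> y + b0" if y: "y \<in> C" for y
  proof (cases "y = 0")
    case True
    have "g \<in> S" using g by auto
    then show ?thesis using True y ab unfolding S_def by auto
  next
    case False
    \<comment> \<open>perturb the linear part in the direction that hurts most at \<open>y\<close>\<close>
    have "(a0 - (d / norm y) *\<^sub>R y, b0) \<in> cball g d"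
      using False g(1) ab by (simp add: dist_Pair_Pair dist_norm)
    then have "0 \<le> (a0 - (d / norm y) *\<^sub>R y) \<bullet> y + b0" using g(2) y unfolding S_def by fastforce
    moreover have "y \<bullet> y = norm y * norm y" by (simp add: dot_square_norm power2_eq_square)
    ultimately show ?thesis using False by (simp add: inner_diff_left)
  qed
  have 2: "d \<le> a0 \<bullet> y + b0" if y: "y \<in> C" for y
  proof -
    have "(a0, b0 - d) \<in> cball g d" using g(1) ab by (simp add: dist_Pair_Pair dist_norm)
    then have "0 \<le> a0 \<bullet> y + (b0 - d)" using g(2) y unfolding S_def by fastforce
    then show ?thesis by simp
  qed
  show ?thesis
  proof
    fix y assume y: "y \<in> C"
    have "d * (norm y + 1) \<le> 2 * (a0 \<bullet> y + b0)" using 1[OF y] 2[OF y] by (simp add: algebra_simps)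
    then have "norm y + 1 \<le> 2 * (a0 \<bullet> y + b0) / d" using g(1) by (simp add: pos_le_divide_eq mult.commute)
    then show "norm y + 1 \<le> ((2 / d) *\<^sub>R a0) \<bullet> y + 2 * b0 / d" by (simp add: add_divide_distrib)
  qed
qed

text \<open>
  Boundedness is where the absence of lines enters: a dominating function at \<open>y\<close> is the mean of its values at \<open>y + v\<close> and
  \<open>y - v\<close>.
\<close>

lemma sym_body_props:
  assumes C: "hilbert_geometry C" "y \<in> C"
  shows "bounded (sym_body C y)" "0 \<in> sym_body C y"
proof -
  show "0 \<in> sym_body C y" using C unfolding sym_body_def by simp
  obtain a b where ab: "\<And>y. y \<in> C \<Longrightarrow> norm y + 1 \<le> a \<bullet> y + b"
    using convex_line_free_dominating_functional[of C] C(1) unfolding hilbert_geometry_def by blast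
  have "norm v \<le> a \<bullet> y + b" if "v \<in> sym_body C y" for v
  proof -
    have "norm (y + v) \<le> a \<bullet> (y + v) + b" "norm (y - v) \<le> a \<bullet> (y - v) + b"
      using that ab[of "y + v"] ab[of "y - v"] unfolding sym_body_def by auto
    then have "norm (y + v) + norm (y - v) \<le> 2 * (a \<bullet> y + b)"
      by (simp add: inner_add_right inner_diff_right)
    moreover have "norm ((y + v) - (y - v)) \<le> norm (y + v) + norm (y - v)" by (rule norm_triangle_ineq4)
    moreover have "(y + v) - (y - v) = 2 *\<^sub>R v" by (simp add: scaleR_2)
    ultimately show ?thesis by simp
  qed
  then show "bounded (sym_body C y)" unfolding bounded_iff by blast
qed

lemma emeasure_lborel_affine_image:
  fixes S :: "'a::euclidean_space set"
  assumes S: "S \<in> sets borel" and c: "c \<noteq> 0"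
  shows "(\<lambda>v. p + c *\<^sub>R v) ` S \<in> sets borel"
    and "emeasure lborel ((\<lambda>v. p + c *\<^sub>R v) ` S) = ennreal (\<bar>c\<bar> ^ DIM('a)) * emeasure lborel S"
proof -
  have eq: "(\<lambda>v. p + c *\<^sub>R v) ` S = (\<lambda>z. (1 / c) *\<^sub>R (z - p)) -` S \<inter> space borel"
  proof (intro set_eqI iffI)
    fix z assume "z \<in> (\<lambda>z. (1 / c) *\<^sub>R (z - p)) -` S \<inter> space borel"
    then show "z \<in> (\<lambda>v. p + c *\<^sub>R v) ` S"
      using c by (intro image_eqI[of _ _ "(1 / c) *\<^sub>R (z - p)"]) auto
  qed (use c in auto)
  show meas: "(\<lambda>v. p + c *\<^sub>R v) ` S \<in> sets borel"
    unfolding eq using S by (intro measurable_sets[of _ borel borel]) auto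
  have "emeasure lebesgue ((\<lambda>v. c *\<^sub>R v + p) ` S) = \<bar>c\<bar> ^ DIM('a) * emeasure lebesgue S"
    by (rule emeasure_lebesgue_affine)
  moreover have "(\<lambda>v. c *\<^sub>R v + p) ` S = (\<lambda>v. p + c *\<^sub>R v) ` S" by (simp add: add.commute)
  ultimately show "emeasure lborel ((\<lambda>v. p + c *\<^sub>R v) ` S) = ennreal (\<bar>c\<bar> ^ DIM('a)) * emeasure lborel S"
    using meas S by simp
qed

lemma emeasure_lborel_open_pos:
  fixes U :: "'a::euclidean_space set"
  assumes "open U" "U \<noteq> {}"
  shows "emeasure lborel U > 0"
proof (rule ccontr)
  assume "\<not> emeasure lborel U > 0"
  then have "U \<in> null_sets lborel" using assms(1) by (simp add: null_sets_def)
  then have "negligible U" using negligible_iff_null_sets null_sets_completionI by blast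
  then show False using open_not_negligible[OF assms] by blast
qed

lemma divide_left_antimono_ennreal:
  fixes a b w :: ennreal
  assumes "a \<le> b"
  shows "w / b \<le> w / a"
proof -
  have "inverse b \<le> inverse a"
    using assms including ennreal.lifting by transfer (auto intro: ereal_inverse_antimono)
  then show ?thesis unfolding divide_ennreal_def by (intro mult_left_mono) auto
qed

text \<open>
  A neighbourhood of \<open>y\<close> of fixed size in the Hilbert metric, whose Busemann volume is bounded below by a universal constant.
\<close>

definition patch :: "'a::real_vector set \<Rightarrow> 'a \<Rightarrow> 'a set" where
  "patch C y = (\<lambda>v. y + (1/2) *\<^sub>R v) ` sym_body C y"

lemma patch_reach:
  assumes C: "convex C" "y \<in> C" and z: "z \<in> patch C y"
  shows "reach C 2 y z" "reach C 2 z y" "z \<in> C"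
proof -
  obtain v where v: "z = y + (1/2) *\<^sub>R v" "y + v \<in> C" "y - v \<in> C"
    using z unfolding patch_def sym_body_def by blast
  have "2 *\<^sub>R z = y + (2 - 1) *\<^sub>R (y + v)" using v by (simp add: algebra_simps scaleR_2)
  then show "reach C 2 y z" using v unfolding reach_def by auto
  have half: "(1/2) *\<^sub>R a + (1/2) *\<^sub>R b \<in> C" if "a \<in> C" "b \<in> C" for a b
    using convexD[OF C(1) that, of "1/2" "1/2"] by simp
  have h2: "(1/2) *\<^sub>R y + (1/2) *\<^sub>R y = y"
    by (simp add: scaleR_add_left[symmetric])
  have "(1/2) *\<^sub>R y + (1/2) *\<^sub>R (y + v) = z" "(1/2) *\<^sub>R y + (1/2) *\<^sub>R (y - v) = y - (1/2) *\<^sub>R v"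
    using h2 v by (auto simp: scaleR_add_right scaleR_diff_right add.assoc[symmetric] add_diff_eq)
  then show "z \<in> C" using half[OF C(2) v(2)] by simp
  have "y - (1/2) *\<^sub>R v \<in> C"
    using half[OF C(2) v(3)] \<open>(1/2) *\<^sub>R y + (1/2) *\<^sub>R (y - v) = y - (1/2) *\<^sub>R v\<close> by simp
  moreover have "2 *\<^sub>R y = z + (2 - 1) *\<^sub>R (y - (1/2) *\<^sub>R v)" using v by (simp add: algebra_simps scaleR_2)
  ultimately show "reach C 2 z y" unfolding reach_def by auto
qed

lemma patch_hilbert_near:
  assumes "convex C" "y \<in> C" "z \<in> patch C y"
  shows "hilbert_near C 4 y z"
  using patch_reach[OF assms] unfolding hilbert_near_def by (intro exI[of _ 2]) auto

text \<open>
  If \<open>y\<close> is the midpoint of \<open>z\<close> and a point of \<open>C\<close>, then halving a vector that is admissible at \<open>z\<close> gives one that is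
  admissible at \<open>y\<close>.
\<close>

lemma finsler_ball_patch:
  assumes C: "hilbert_geometry C" "y \<in> C" and z: "z \<in> patch C y"
  shows "finsler_ball C z \<subseteq> (\<lambda>v. 0 + 4 *\<^sub>R v) ` sym_body C y"
proof
  note cv = hilbert_geometryD(2)[OF C(1)]
  fix w assume "w \<in> finsler_ball C z"
  then obtain v where v: "w = 2 *\<^sub>R v" "z + v \<in> C" "z - v \<in> C"
    using finsler_ball_subset_sym_body[OF C(1) patch_reach(3)[OF cv C(2) z]] unfolding sym_body_def by blast
  obtain c where c: "c \<in> C" "2 *\<^sub>R y = z + c"
    using patch_reach(2)[OF cv C(2) z] unfolding reach_def by auto
  have half: "(1/2) *\<^sub>R a + (1/2) *\<^sub>R b \<in> C" if "a \<in> C" "b \<in> C" for a b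
    using convexD[OF cv that, of "1/2" "1/2"] by simp
  have y: "y = (1/2) *\<^sub>R z + (1/2) *\<^sub>R c"
    using arg_cong[OF c(2), of "\<lambda>u. (1/2) *\<^sub>R u"] by (simp add: scaleR_add_right)
  have "y + (1/2) *\<^sub>R v = (1/2) *\<^sub>R (z + v) + (1/2) *\<^sub>R c" "y - (1/2) *\<^sub>R v = (1/2) *\<^sub>R (z - v) + (1/2) *\<^sub>R c"
    unfolding y by (simp_all add: algebra_simps)
  then have "(1/2) *\<^sub>R v \<in> sym_body C y"
    unfolding sym_body_def using half[OF v(2) c(1)] half[OF v(3) c(1)] by simp
  then show "w \<in> (\<lambda>v. 0 + 4 *\<^sub>R v) ` sym_body C y"
    using v by (intro image_eqI[of _ _ "(1/2) *\<^sub>R v"]) auto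
qed

text \<open>
  On the patch around \<open>y\<close> the density is at least \<open>\<omega> / (4 ^ n * L)\<close> with \<open>L\<close> the volume of the symmetric body at \<open>y\<close>, and the
  patch has volume \<open>L / 2 ^ n\<close>.  So each patch contributes \<open>\<omega> / 8 ^ n\<close>, whatever \<open>C\<close> and \<open>y\<close> are, and separation makes
  the patches disjoint.
\<close>

lemma busemann_volume_ge_packing:
  fixes C :: "(real ^ 'n) set"
  assumes C: "hilbert_geometry C" and S: "finite S" "S \<subseteq> C"
    and sep: "pairwise (\<lambda>y z. \<not> hilbert_near C 16 y z) S"
    and A: "\<And>y. y \<in> S \<Longrightarrow> patch C y \<subseteq> A"
  shows "of_nat (card S) * (emeasure lborel (ball (0 :: real ^ 'n) 1) / 8 ^ CARD('n)) \<le> busemann_volume C A"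
proof -
  let ?w = "emeasure lborel (ball (0 :: real ^ 'n) 1)"
  let ?n = "CARD('n)"
  note cv = hilbert_geometryD(2)[OF C]
  define L where "L y = emeasure lborel (sym_body C y)" for y
  have borel: "sym_body C y \<in> sets borel" for y
    using open_sym_body[OF hilbert_geometryD(1)[OF C]] by simp
  have pborel: "patch C y \<in> sets borel" for y
    unfolding patch_def by (rule emeasure_lborel_affine_image[OF borel]) simp
  have disj: "patch C y \<inter> patch C z = {}" if "y \<in> S" "z \<in> S" "y \<noteq> z" for y z
  proof (rule ccontr)
    assume "patch C y \<inter> patch C z \<noteq> {}"
    then obtain u where "u \<in> patch C y" "u \<in> patch C z" by blast
    then have "hilbert_near C (4 * 4) y z"
      using patch_hilbert_near[OF cv] hilbert_near_sym that S hilbert_near_trans[OF cv] by (metis subsetD)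
    then show False using sep that unfolding pairwise_def by auto
  qed
  define f where "f z = (\<Sum>y\<in>S. ?w / (4 ^ ?n * L y) * indicator (patch C y) z)" for z
  have "f z \<le> ?w / emeasure lborel (finsler_ball C z) * indicator A z" for z
  proof (cases "\<exists>y\<in>S. z \<in> patch C y")
    case True
    then obtain y where y: "y \<in> S" "z \<in> patch C y" by blast
    have "f z = (\<Sum>y'\<in>{y}. ?w / (4 ^ ?n * L y') * indicator (patch C y') z)"
      unfolding f_def using S y disj by (intro sum.mono_neutral_right) (auto simp: indicator_def)
    then have fz: "f z = ?w / (4 ^ ?n * L y)" using y by simp
    have "emeasure lborel (finsler_ball C z) \<le> emeasure lborel ((\<lambda>v. 0 + 4 *\<^sub>R v) ` sym_body C y)"
      using finsler_ball_patch[OF C _ y(2)] y S emeasure_lborel_affine_image(1)[OF borel, of 4 0 y]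
      by (intro emeasure_mono) auto
    also have "\<dots> = 4 ^ ?n * L y"
      using emeasure_lborel_affine_image(2)[OF borel, of 4 0 y] unfolding L_def
      by (simp add: ennreal_power[symmetric])
    finally have "f z \<le> ?w / emeasure lborel (finsler_ball C z)"
      unfolding fz by (rule divide_left_antimono_ennreal)
    then show ?thesis using A y by (auto simp: indicator_def)
  next
    case False
    then have "f z = 0" unfolding f_def by (intro sum.neutral) auto
    then show ?thesis by simp
  qed
  then have "(\<integral>\<^sup>+z. f z \<partial>lborel) \<le> busemann_volume C A"
    unfolding busemann_volume_def by (intro nn_integral_mono)
  moreover have "(\<integral>\<^sup>+z. f z \<partial>lborel) = (\<Sum>y\<in>S. ?w / (4 ^ ?n * L y) * emeasure lborel (patch C y))"
    unfolding f_def using pborel by (subst nn_integral_sum) (auto simp: nn_integral_cmult_indicator)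
  moreover have "?w / (4 ^ ?n * L y) * emeasure lborel (patch C y) = ?w / 8 ^ ?n" if y: "y \<in> S" for y
  proof -
    have yC: "y \<in> C" using y S by blast
    have "L y < \<infinity>" unfolding L_def
      using emeasure_bounded_finite[OF sym_body_props(1)[OF C yC]] by simp
    moreover have "L y > 0" unfolding L_def
      using sym_body_props(2)[OF C yC] open_sym_body[OF hilbert_geometryD(1)[OF C], of y]
      by (intro emeasure_lborel_open_pos) auto
    ultimately obtain l where l: "L y = ennreal l" "l > 0"
      by (cases "L y") auto
    have "emeasure lborel (patch C y) = ennreal ((1 / 2) ^ ?n) * L y"
      unfolding patch_def L_def using emeasure_lborel_affine_image(2)[OF borel, of "1/2" y y] by simp
    then have pe: "emeasure lborel (patch C y) = ennreal ((1 / 2) ^ ?n * l)"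
      using l by (simp add: ennreal_mult)
    have "?w < \<infinity>" using emeasure_bounded_finite[of "ball (0::real^'n) 1"] by simp
    then obtain w where w: "?w = ennreal w" "w \<ge> 0" by (cases ?w) auto
    have four: "(4::ennreal) ^ ?n = ennreal (4 ^ ?n)" "(8::ennreal) ^ ?n = ennreal (8 ^ ?n)"
      by (simp_all add: ennreal_power[symmetric])
    have "?w / (4 ^ ?n * L y) = ennreal (w / (4 ^ ?n * l))"
      unfolding w(1) l(1) four using w l by (simp add: ennreal_mult[symmetric] divide_ennreal)
    then have "?w / (4 ^ ?n * L y) * emeasure lborel (patch C y) = ennreal (w / (4 ^ ?n * l) * ((1 / 2) ^ ?n * l))"
      unfolding pe \<open>?w / (4 ^ ?n * L y) = ennreal (w / (4 ^ ?n * l))\<close>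
      using w l by (intro ennreal_mult[symmetric]) auto
    also have "w / (4 ^ ?n * l) * ((1 / 2) ^ ?n * l) = w / 8 ^ ?n"
    proof -
      have "(8::real) ^ ?n = 4 ^ ?n * 2 ^ ?n" by (simp add: power_mult_distrib[symmetric])
      then show ?thesis using l by (simp add: power_one_over field_simps)
    qed
    also have "ennreal (w / 8 ^ ?n) = ?w / 8 ^ ?n"
      unfolding w(1) four using w by (simp add: divide_ennreal)
    finally show ?thesis .
  qed
  ultimately show ?thesis by simp
qed

section \<open>Exposed points and packings\<close>

text \<open>
  The supporting hyperplane with normal \<open>a\<close> touches \<open>D\<close> in \<open>e\<close> only.
\<close>

definition exposed_by :: "'a::real_inner set \<Rightarrow> 'a \<Rightarrow> 'a \<Rightarrow> bool" where
  "exposed_by D a e \<longleftrightarrow> e \<in> D \<and> (\<forall>y\<in>D. y \<noteq> e \<longrightarrow> a \<bullet> e < a \<bullet> y)"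

text \<open>
  \<open>D\<close> lies in a ball about \<open>c\<close> that has \<open>f\<close> on its boundary, and a ball is strictly convex.
\<close>

lemma farthest_point_exposed:
  fixes D :: "'a::real_inner set"
  assumes "f \<in> D" "\<And>y. y \<in> D \<Longrightarrow> dist c y \<le> dist c f"
  shows "exposed_by D (c - f) f"
  unfolding exposed_by_def
proof (intro conjI ballI impI)
  fix y assume y: "y \<in> D" "y \<noteq> f"
  have "(norm (y - c))\<^sup>2 \<le> (norm (f - c))\<^sup>2"
    using assms(2)[OF y(1)] by (simp add: dist_norm norm_minus_commute power_mono)
  moreover have "(norm (y - c))\<^sup>2 = (norm (y - f))\<^sup>2 + 2 * ((c - f) \<bullet> f) - 2 * ((c - f) \<bullet> y) + (norm (f - c))\<^sup>2"
    by (simp add: power2_norm_eq_inner inner_diff_left inner_diff_right inner_commute)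
  moreover have "(norm (y - f))\<^sup>2 > 0" using y by simp
  ultimately show "(c - f) \<bullet> f < (c - f) \<bullet> y" by linarith
qed (rule assms(1))

text \<open>
  A point outside the hull of the exposed points is separated from the hull by a hyperplane, and hence by a sphere with
  a distant centre.  The point of \<open>D\<close> farthest from this centre is exposed, although it lies outside the sphere.
\<close>

lemma finitely_many_exposed_imp_polytope:
  fixes D :: "'a::euclidean_space set"
  assumes D: "convex D" "compact D" and fin: "finite {e. \<exists>a. exposed_by D a e}"
  shows "polytope D"
proof -
  define X where "X = {e. \<exists>a. exposed_by D a e}"
  have XD: "X \<subseteq> D" unfolding X_def exposed_by_def by auto
  have fX: "finite X" using fin unfolding X_def .
  have "z \<in> convex hull X" if z: "z \<in> D" for z
  proof (rule ccontr)
    assume nz: "z \<notin> convex hull X"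
    have "closed (convex hull X)"
      by (intro compact_imp_closed finite_imp_compact_convex_hull fX)
    then obtain a b where ab: "a \<bullet> z < b" "\<And>x. x \<in> convex hull X \<Longrightarrow> b < a \<bullet> x"
      using separating_hyperplane_closed_point[OF convex_convex_hull _ nz] by metis
    obtain R where R: "\<And>x. x \<in> D \<Longrightarrow> dist z x \<le> R"
      using compact_imp_bounded[OF D(2)] bounded_any_center[of D z] by auto
    have "R \<ge> 0" using R[OF z] by simp
    \<comment> \<open>so large that, seen from \<open>c\<close>, points of \<open>D\<close> beyond the hyperplane are closer than \<open>z\<close>\<close>
    define t where "t = (R\<^sup>2 + 1) / (b - a \<bullet> z)"
    have tpos: "t > 0" unfolding t_def using ab by (intro divide_pos_pos) (auto intro: add_nonneg_pos)
    define c where "c = z + t *\<^sub>R a"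
    obtain f where f: "f \<in> D" "\<And>y. y \<in> D \<Longrightarrow> dist c y \<le> dist c f"
      using distance_attains_sup[of D c] D z by auto
    have "f \<in> X" unfolding X_def using farthest_point_exposed[OF f] by auto
    then have "b < a \<bullet> f" by (intro ab hull_inc)
    have "(norm (f - c))\<^sup>2 = (norm (f - z))\<^sup>2 - 2 * (t * (a \<bullet> f - a \<bullet> z)) + (norm (z - c))\<^sup>2"
      unfolding c_def
      by (simp add: power2_norm_eq_inner inner_diff_left inner_diff_right inner_add_left inner_add_right
          inner_commute algebra_simps) (simp add: power2_eq_square)
    moreover have "(norm (f - z))\<^sup>2 \<le> R\<^sup>2"
      using R[OF f(1)] by (intro power_mono) (auto simp: dist_norm norm_minus_commute)
    moreover have "t * (b - a \<bullet> z) \<le> t * (a \<bullet> f - a \<bullet> z)"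
      using tpos \<open>b < a \<bullet> f\<close> by (intro mult_left_mono) auto
    moreover have "t * (b - a \<bullet> z) = R\<^sup>2 + 1" unfolding t_def using ab by simp
    moreover have "(norm (z - c))\<^sup>2 \<le> (norm (f - c))\<^sup>2"
      using f(2)[OF z] by (intro power_mono) (auto simp: dist_norm norm_minus_commute)
    moreover have "R\<^sup>2 \<ge> 0" by simp
    ultimately show False by linarith
  qed
  moreover have "convex hull X \<subseteq> D" by (intro hull_minimal XD D(1))
  ultimately have "D = convex hull X" by auto
  then show ?thesis unfolding polytope_def using fX by auto
qed

lemma exposed_interior_less:
  fixes D :: "'a::euclidean_space set"
  assumes D: "convex D" "p \<in> rel_interior D" "aff_dim D > 0" and e: "exposed_by D a e"
  shows "a \<bullet> e < a \<bullet> p"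
proof -
  have pD: "p \<in> D" using D rel_interior_subset by auto
  have "p \<noteq> e"
  proof
    assume pe: "p = e"
    have "D \<noteq> {p}" using D(3) by auto
    then obtain q where q: "q \<in> D" "q \<noteq> p" using pD by auto
    obtain t where t: "t > 1" "(1 - t) *\<^sub>R q + t *\<^sub>R p \<in> D"
      using D(2) q convex_rel_interior_iff[OF D(1), of p] by auto
    have "a \<bullet> p \<le> a \<bullet> ((1 - t) *\<^sub>R q + t *\<^sub>R p)"
      using e t(2) pe unfolding exposed_by_def by (cases "(1 - t) *\<^sub>R q + t *\<^sub>R p = e") auto
    also have "\<dots> = a \<bullet> p - (t - 1) * (a \<bullet> q - a \<bullet> p)"
      by (simp add: inner_add_right algebra_simps)
    finally have "(t - 1) * (a \<bullet> q - a \<bullet> p) \<le> 0" by simp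
    moreover have "(t - 1) * (a \<bullet> q - a \<bullet> p) > 0"
      using e q t(1) pe unfolding exposed_by_def by (intro mult_pos_pos) auto
    ultimately show False by simp
  qed
  then show ?thesis using e pD unfolding exposed_by_def by auto
qed

text \<open>
  The sum of the two supporting functions vanishes nowhere on \<open>D\<close>, so it has a positive minimum.  Where the second function is
  small, the first is bounded below.
\<close>

lemma exposed_levels_separate:
  fixes D :: "'a::euclidean_space set"
  assumes D: "compact D" and e: "exposed_by D a e" "exposed_by D a' e'" "e \<noteq> e'"
  shows "eventually (\<lambda>s. \<forall>y\<in>D. \<forall>z\<in>D. a \<bullet> y - a \<bullet> e \<le> (1 / 32) ^ s * B \<longrightarrow>
            a' \<bullet> z - a' \<bullet> e' \<le> (1 / 32) ^ s * B' \<longrightarrow> 0 < a \<bullet> y - a \<bullet> e \<longrightarrow>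
            16 * (a \<bullet> y - a \<bullet> e) < a \<bullet> z - a \<bullet> e) sequentially"
proof -
  let ?l = "\<lambda>y. (a \<bullet> y - a \<bullet> e) + (a' \<bullet> y - a' \<bullet> e')"
  have ne: "D \<noteq> {}" using e unfolding exposed_by_def by auto
  have "continuous_on D ?l" by (intro continuous_intros)
  then obtain w where w: "w \<in> D" "\<And>y. y \<in> D \<Longrightarrow> ?l w \<le> ?l y"
    using continuous_attains_inf[OF D ne, of ?l] by auto
  have "?l w > 0"
  proof (cases "w = e")
    case True
    then have "a' \<bullet> w - a' \<bullet> e' > 0" using e(2,3) w(1) unfolding exposed_by_def by auto
    then show ?thesis using True by simp
  next
    case False
    then have "a \<bullet> w - a \<bullet> e > 0" using e(1) w(1) unfolding exposed_by_def by auto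
    moreover have "a' \<bullet> w - a' \<bullet> e' \<ge> 0" using e(2) w(1) unfolding exposed_by_def by (cases "w = e'") auto
    ultimately show ?thesis by simp
  qed
  have lim: "(\<lambda>s. (1 / 32 :: real) ^ s * b) \<longlonglongrightarrow> 0" for b
    using tendsto_mult_right[OF LIMSEQ_realpow_zero[of "1/32"], of b] by simp
  have "eventually (\<lambda>s. (1 / 32) ^ s * B < ?l w / 32) sequentially"
    using order_tendstoD(2)[OF lim, of "?l w / 32" B] \<open>?l w > 0\<close> by simp
  moreover have "eventually (\<lambda>s. (1 / 32) ^ s * B' < ?l w / 32) sequentially"
    using order_tendstoD(2)[OF lim, of "?l w / 32" B'] \<open>?l w > 0\<close> by simp
  ultimately show ?thesis
  proof eventually_elim
    case (elim s)
    show ?case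
    proof (intro ballI impI)
      fix y z assume yz: "y \<in> D" "z \<in> D" "a \<bullet> y - a \<bullet> e \<le> (1 / 32) ^ s * B"
        "a' \<bullet> z - a' \<bullet> e' \<le> (1 / 32) ^ s * B'"
      define m u v where "m = ?l w" and "u = a \<bullet> y - a \<bullet> e" and "v = a \<bullet> z - a \<bullet> e"
      have "m \<le> v + (a' \<bullet> z - a' \<bullet> e')" using w(2)[OF yz(2)] unfolding m_def v_def .
      moreover have "a' \<bullet> z - a' \<bullet> e' < m / 32" "u < m / 32"
        unfolding m_def u_def
        by (rule le_less_trans[OF yz(4) elim(2)], rule le_less_trans[OF yz(3) elim(1)])
      moreover have "0 < m" using \<open>?l w > 0\<close> unfolding m_def .
      ultimately have "16 * u < v" by linarith
      then show "16 * (a \<bullet> y - a \<bullet> e) < a \<bullet> z - a \<bullet> e" unfolding u_def v_def .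
    qed
  qed
qed

text \<open>
  The slices at sufficiently low levels of the supporting function shrink to the exposed point, so they can be used
  simultaneously at all points of \<open>E\<close>.  Every exposed point contributes its own \<open>N\<close> slices with \<open>N ^ k\<close> points each.  The
  starting level and the cost of the way back depend on \<open>E\<close>, but they affect only the factor \<open>c\<close>, not the exponential
  rate; this is why the number of exposed points survives in the growth rate.
\<close>

theorem exposed_packing:
  fixes D :: "'a::euclidean_space set"
  assumes D: "convex D" "compact D" "p \<in> rel_interior D" "aff_dim D = int (Suc k)"
    and E: "finite E" "\<And>e. e \<in> E \<Longrightarrow> \<exists>a. exposed_by D a e"
  shows "\<exists>c\<ge>1. \<forall>N. \<exists>S. packing D (c * 32 ^ (Suc k * N)) p S \<and> card S = card E * N ^ Suc k"
proof -
  have pD: "p \<in> D" using D(3) rel_interior_subset by auto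
  have "\<forall>e\<in>E. \<exists>a. exposed_by D a e" using E(2) by simp
  then obtain a where a': "\<forall>e\<in>E. exposed_by D (a e) e" by (rule bchoice[THEN exE])
  have a: "exposed_by D (a e) e" if "e \<in> E" for e using a' that by simp
  have eD: "e \<in> D" if "e \<in> E" for e using a[OF that] unfolding exposed_by_def by simp
  have ge: "a e \<bullet> e \<le> a e \<bullet> y" if "e \<in> E" "y \<in> D" for e y
    using a[OF that(1)] that(2) unfolding exposed_by_def by (cases "y = e") auto
  have ap: "a e \<bullet> e < a e \<bullet> p" if "e \<in> E" for e
    using exposed_interior_less[OF D(1,3) _ a[OF that]] D(4) by simp
  have "\<exists>d>0. p + d *\<^sub>R (p - e) \<in> D" if "e \<in> E" for e
  proof -
    have "e \<in> D" "D \<noteq> {}" using pD eD that by auto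
    then obtain t where t: "t > 1" "(1 - t) *\<^sub>R e + t *\<^sub>R p \<in> D"
      using D(3) convex_rel_interior_iff[OF D(1)] by metis
    moreover have "(1 - t) *\<^sub>R e + t *\<^sub>R p = p + (t - 1) *\<^sub>R (p - e)" by (simp add: algebra_simps)
    ultimately show ?thesis by (intro exI[of _ "t - 1"]) simp
  qed
  then obtain d where d: "\<And>e. e \<in> E \<Longrightarrow> d e > 0" "\<And>e. e \<in> E \<Longrightarrow> p + d e *\<^sub>R (p - e) \<in> D"
    by metis
  \<comment> \<open>one bound for the way back that serves all points of \<open>E\<close>\<close>
  define c0 where "c0 = 1 + (\<Sum>e\<in>E. 1 / d e)"
  have c0: "1 + 1 / d e \<le> c0" if "e \<in> E" for e
    unfolding c0_def using member_le_sum[of e E "\<lambda>e. 1 / d e"] E(1) that d(1) by (simp add: less_imp_le)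
  have "c0 \<ge> 1" unfolding c0_def using d(1) by (simp add: sum_nonneg less_imp_le)
  have "eventually (\<lambda>s. \<forall>e\<in>E. \<forall>e'\<in>E. e \<noteq> e' \<longrightarrow> (\<forall>y\<in>D. \<forall>z\<in>D.
            a e \<bullet> y - a e \<bullet> e \<le> (1 / 32) ^ s * (a e \<bullet> p - a e \<bullet> e) \<longrightarrow>
            a e' \<bullet> z - a e' \<bullet> e' \<le> (1 / 32) ^ s * (a e' \<bullet> p - a e' \<bullet> e') \<longrightarrow> 0 < a e \<bullet> y - a e \<bullet> e \<longrightarrow>
            16 * (a e \<bullet> y - a e \<bullet> e) < a e \<bullet> z - a e \<bullet> e)) sequentially"
  proof (intro eventually_ball_finite[OF E(1)] ballI)
    fix e e' assume ee: "e \<in> E" "e' \<in> E"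
    show "eventually (\<lambda>s. e \<noteq> e' \<longrightarrow> (\<forall>y\<in>D. \<forall>z\<in>D.
            a e \<bullet> y - a e \<bullet> e \<le> (1 / 32) ^ s * (a e \<bullet> p - a e \<bullet> e) \<longrightarrow>
            a e' \<bullet> z - a e' \<bullet> e' \<le> (1 / 32) ^ s * (a e' \<bullet> p - a e' \<bullet> e') \<longrightarrow> 0 < a e \<bullet> y - a e \<bullet> e \<longrightarrow>
            16 * (a e \<bullet> y - a e \<bullet> e) < a e \<bullet> z - a e \<bullet> e)) sequentially"
    proof (cases "e = e'")
      case False
      show ?thesis
        by (rule eventually_mono[OF exposed_levels_separate[OF D(2) a[OF ee(1)] a[OF ee(2)] False]]) (rule impI)
    qed simp
  qed
  then obtain s0 where s0: "\<And>e e' y z. \<lbrakk>e \<in> E; e' \<in> E; e \<noteq> e'; y \<in> D; z \<in> D;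
            a e \<bullet> y - a e \<bullet> e \<le> (1 / 32) ^ s0 * (a e \<bullet> p - a e \<bullet> e);
            a e' \<bullet> z - a e' \<bullet> e' \<le> (1 / 32) ^ s0 * (a e' \<bullet> p - a e' \<bullet> e'); 0 < a e \<bullet> y - a e \<bullet> e\<rbrakk> \<Longrightarrow>
            16 * (a e \<bullet> y - a e \<bullet> e) < a e \<bullet> z - a e \<bullet> e"
    unfolding eventually_sequentially by (meson order_refl)
  have t: "0 < (1 / 32 :: real) ^ s" "(1 / 32 :: real) ^ s \<le> 1" for s by (auto simp: power_le_one)
  define q where "q e s = e + ((1 / 32) ^ s) *\<^sub>R (p - e)" for e and s :: nat
  have near: "hilbert_near D (c0 * 32 ^ s) p (q e s)" if e: "e \<in> E" for e s
  proof -
    have "reach D (32 ^ s) p (q e s)" "reach D (1 + 1 / d e) (q e s) p"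
      using reach_towards[OF eD[OF e] t[of s], of p] d[OF e]
        reach_back[OF D(1) pD less_imp_le[OF t(1)] t(2), of "d e" e s]
      unfolding q_def by (simp_all add: power_one_over)
    moreover have "32 ^ s * (1 + 1 / d e) \<le> c0 * 32 ^ s" using c0[OF e] by simp
    ultimately show ?thesis by (rule hilbert_nearI)
  qed
  have card_pos: "c0 * 32 ^ s0 \<ge> 1"
    using \<open>c0 \<ge> 1\<close> mult_mono[of 1 c0 1 "32 ^ s0"] by simp
  have "\<exists>S. packing D (c0 * 32 ^ s0 * 32 ^ (Suc k * N)) p S \<and> card S = card E * N ^ Suc k" for N
  proof -
    have "\<exists>S. packing D (32 ^ (k * N)) (q e s) S \<and> card S = N ^ k \<and> S \<subseteq> {y. a e \<bullet> y = a e \<bullet> q e s}"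
      if e: "e \<in> E" for e s
    proof -
      note sl = slice_point[OF D(1-3) eD[OF e] ap[OF e] t q_def[of e s]]
      obtain S where S: "packing (D \<inter> {y. a e \<bullet> y = a e \<bullet> q e s}) (32 ^ (k * N)) (q e s) S" "card S = N ^ k"
        using polynomial_packing[OF sl(3,4,5), of k N] sl(6) D(4) by auto
      then show ?thesis using packing_slice[OF S(1) sl(2)] packingD(2)[OF S(1)] by auto
    qed
    then obtain S where S: "\<And>e s. e \<in> E \<Longrightarrow> packing D (32 ^ (k * N)) (q e s) (S e s)"
        "\<And>e s. e \<in> E \<Longrightarrow> card (S e s) = N ^ k"
        "\<And>e s. e \<in> E \<Longrightarrow> S e s \<subseteq> {y. a e \<bullet> y = a e \<bullet> q e s}"
      by metis
    have level: "a e \<bullet> y - a e \<bullet> e = (1 / 32) ^ s * (a e \<bullet> p - a e \<bullet> e)" if "e \<in> E" "y \<in> S e s" for y e s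
    proof -
      have "a e \<bullet> y = a e \<bullet> q e s" using that S(3)[OF that(1), of s] by auto
      then show ?thesis using slice_point(1)[OF D(1-3) eD[OF that(1)] ap[OF that(1)] t q_def[of e s]] by simp
    qed
    have pos: "0 < a e \<bullet> y - a e \<bullet> e" if "e \<in> E" "y \<in> S e s" for y e s
      unfolding level[OF that] using ap[OF that(1)] by simp
    have inD: "y \<in> D" if "e \<in> E" "y \<in> S e s" for y e s
      using packingD(2)[OF S(1)[OF that(1), of s]] that(2) by auto
    have sep_same: "\<not> hilbert_near D 16 y z" if e: "e \<in> E" and st: "y \<in> S e s" "z \<in> S e u" "s < u" for e y z s u
    proof -
      have "(1 / 32 :: real) ^ u \<le> (1 / 32) ^ Suc s"
        using st by (intro power_decreasing) auto
      then have "(1 / 32) ^ u * (a e \<bullet> p - a e \<bullet> e) \<le> (1 / 32) ^ Suc s * (a e \<bullet> p - a e \<bullet> e)"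
        using ap[OF e] by (intro mult_right_mono) auto
      moreover have "(1 / 32) ^ s * (a e \<bullet> p - a e \<bullet> e) > 0" using ap[OF e] by simp
      ultimately have "16 * (a e \<bullet> z - a e \<bullet> e) < a e \<bullet> y - a e \<bullet> e"
        unfolding level[OF e st(1)] level[OF e st(2)] by simp
      then show ?thesis using ge[OF e] pos[OF e st(2)] by (intro level_separation[where b = "a e \<bullet> e"]) auto
    qed
    have low: "a e \<bullet> y - a e \<bullet> e \<le> (1 / 32) ^ s0 * (a e \<bullet> p - a e \<bullet> e)"
      if "e \<in> E" "y \<in> S e s" "s0 \<le> s" for e y s
      unfolding level[OF that(1,2)] using that(3) ap[OF that(1)]
      by (intro mult_right_mono power_decreasing) auto
    have sep_diff: "\<not> hilbert_near D 16 y z"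
      if "e \<in> E" "e' \<in> E" "e \<noteq> e'" "y \<in> S e s" "z \<in> S e' u" "s0 \<le> s" "s0 \<le> u" for e e' y z s u
    proof -
      have "16 * (a e \<bullet> y - a e \<bullet> e) < a e \<bullet> z - a e \<bullet> e"
        by (rule s0[OF that(1-3) inD[OF that(1,4)] inD[OF that(2,5)] low[OF that(1,4,6)] low[OF that(2,5,7)]
              pos[OF that(1,4)]])
      then have "\<not> hilbert_near D 16 z y"
        using ge[OF that(1)] pos[OF that(1,4)] by (intro level_separation[where b = "a e \<bullet> e"]) auto
      then show ?thesis using hilbert_near_sym by auto
    qed
    let ?I = "E \<times> {s0..<s0 + N}"
    have fin: "finite ?I" using E(1) by simp
    have 1: "packing D (c0 * 32 ^ s0 * 32 ^ (Suc k * N)) p (S (fst i) (snd i))" if "i \<in> ?I" for i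
    proof -
      have e: "fst i \<in> E" and s: "snd i < s0 + N" using that by auto
      have "packing D (c0 * 32 ^ snd i * 32 ^ (k * N)) p (S (fst i) (snd i))"
        by (rule packing_shift[OF D(1) near[OF e] S(1)[OF e]])
      moreover have "c0 * 32 ^ snd i * 32 ^ (k * N) \<le> c0 * 32 ^ (s0 + N) * 32 ^ (k * N)"
        using s \<open>c0 \<ge> 1\<close> by (intro mult_right_mono mult_left_mono power_increasing) auto
      ultimately have "packing D (c0 * 32 ^ (s0 + N) * 32 ^ (k * N)) p (S (fst i) (snd i))"
        by (rule packing_mono)
      then show ?thesis by (simp add: power_add mult.assoc)
    qed
    have 2: "card (S (fst i) (snd i)) = N ^ k" if "i \<in> ?I" for i using that S(2) by auto
    have 3: "\<not> hilbert_near D 16 y z"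
      if ij: "i \<in> ?I" "j \<in> ?I" "i \<noteq> j" "y \<in> S (fst i) (snd i)" "z \<in> S (fst j) (snd j)" for i j y z
    proof (cases "fst i = fst j")
      case False
      then show ?thesis using sep_diff[OF _ _ False ij(4,5)] ij(1,2) by auto
    next
      case True
      then have "snd i \<noteq> snd j" using ij(3) by (simp add: prod_eq_iff)
      then consider "snd i < snd j" | "snd j < snd i" by linarith
      then show ?thesis
      proof cases
        case 1
        have "z \<in> S (fst i) (snd j)" using ij(5) True by simp
        then show ?thesis using sep_same[OF _ ij(4) _ 1] ij(1) by auto
      next
        case 2
        have "z \<in> S (fst i) (snd j)" using ij(5) True by simp
        then have "\<not> hilbert_near D 16 z y" using sep_same[OF _ _ ij(4) 2] ij(1) by auto
        then show ?thesis using hilbert_near_sym by auto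
      qed
    qed
    note UN = packing_UN[OF fin 1 2 3]
    have "card (\<Union>i\<in>?I. S (fst i) (snd i)) = card E * N ^ Suc k"
      using UN(2) by (simp add: card_cartesian_product)
    then show ?thesis using UN(1) by (intro exI conjI)
  qed
  then show ?thesis using card_pos by (intro exI[of _ "c0 * 32 ^ s0"]) simp
qed

section \<open>Bounded projective images\<close>

text \<open>
  A projective map written in homogeneous coordinates: the point \<open>(y, 1)\<close> of the cone over \<open>C\<close> is moved along its ray to the
  hyperplane on which \<open>(a, b)\<close> has the value one.
\<close>

definition proj :: "'a::real_inner \<Rightarrow> real \<Rightarrow> 'a \<Rightarrow> 'a \<times> real" where
  "proj a b y = (1 / (a \<bullet> y + b)) *\<^sub>R (y, 1)"

lemma fst_proj: "fst (proj a b y) = (1 / (a \<bullet> y + b)) *\<^sub>R y"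
  and snd_proj: "snd (proj a b y) = 1 / (a \<bullet> y + b)"
  unfolding proj_def by simp_all

lemma inverse_proj: "a \<bullet> y + b > 0 \<Longrightarrow> (1 / snd (proj a b y)) *\<^sub>R fst (proj a b y) = y"
  unfolding fst_proj snd_proj by simp

text \<open>
  In homogeneous coordinates the defining equation of \<open>reach\<close> is only rescaled; the ratio changes by the quotient of the values of
  the affine function at \<open>p\<close> and \<open>q\<close>.
\<close>

lemma reach_proj:
  assumes pos: "\<And>c. c \<in> C \<Longrightarrow> 0 < a \<bullet> c + b" and p: "p \<in> C" and q: "q \<in> C"
    and l: "reach C l p q"
  shows "reach (proj a b ` C) (l * (a \<bullet> q + b) / (a \<bullet> p + b)) (proj a b p) (proj a b q)"
proof -
  obtain c where c: "c \<in> C" "l *\<^sub>R q = p + (l - 1) *\<^sub>R c" "1 \<le> l"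
    using l unfolding reach_def by auto
  define P Q M where "P = a \<bullet> p + b" and "Q = a \<bullet> q + b" and "M = a \<bullet> c + b"
  have PQM: "P > 0" "Q > 0" "M > 0" unfolding P_def Q_def M_def using pos p q c by auto
  have "l * (a \<bullet> q) = a \<bullet> p + (l - 1) * (a \<bullet> c)"
    using arg_cong[OF c(2), of "\<lambda>v. a \<bullet> v"] by (simp add: inner_add_right)
  then have lQ: "l * Q = P + (l - 1) * M" unfolding P_def Q_def M_def by (simp add: algebra_simps)
  then have l': "l * Q / P - 1 = (l - 1) * M / P" using PQM by (simp add: field_simps)
  have "(l * Q / P) *\<^sub>R proj a b q = (1 / P) *\<^sub>R (l *\<^sub>R q, l)"
    unfolding proj_def Q_def[symmetric] using PQM by simp
  also have "\<dots> = (1 / P) *\<^sub>R (p, 1) + ((l - 1) / P) *\<^sub>R (c, 1)"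
    unfolding c(2) by (simp add: scaleR_add_right add_divide_distrib[symmetric])
  also have "\<dots> = proj a b p + ((l - 1) * M / P) *\<^sub>R proj a b c"
    unfolding proj_def P_def[symmetric] M_def[symmetric] using PQM by simp
  finally have "(l * Q / P) *\<^sub>R proj a b q = proj a b p + (l * Q / P - 1) *\<^sub>R proj a b c"
    unfolding l' .
  moreover have "0 \<le> (l - 1) * M / P" using c(3) PQM by simp
  then have "1 \<le> l * Q / P" using l' by simp
  ultimately show ?thesis using c(1) unfolding reach_def P_def Q_def by auto
qed

lemma reach_unproj:
  assumes pos: "\<And>c. c \<in> C \<Longrightarrow> 0 < a \<bullet> c + b" and p: "p \<in> C" and q: "q \<in> C"
    and l: "reach (proj a b ` C) l (proj a b p) (proj a b q)"
  shows "reach C (l * (a \<bullet> p + b) / (a \<bullet> q + b)) p q"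
proof -
  obtain c where c: "c \<in> C" "l *\<^sub>R proj a b q = proj a b p + (l - 1) *\<^sub>R proj a b c" "1 \<le> l"
    using l unfolding reach_def by auto
  define P Q M where "P = a \<bullet> p + b" and "Q = a \<bullet> q + b" and "M = a \<bullet> c + b"
  have PQM: "P > 0" "Q > 0" "M > 0" unfolding P_def Q_def M_def using pos p q c by auto
  have "l * (1 / Q) = 1 / P + (l - 1) * (1 / M)"
    using arg_cong[OF c(2), of snd] unfolding P_def Q_def M_def by (simp add: snd_proj)
  then have l': "l * P / Q - 1 = (l - 1) * P / M" using PQM by (simp add: field_simps)
  have "(l / Q) *\<^sub>R q = (1 / P) *\<^sub>R p + ((l - 1) / M) *\<^sub>R c"
    using arg_cong[OF c(2), of fst] unfolding P_def Q_def M_def by (simp add: fst_proj)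
  then have "P *\<^sub>R ((l / Q) *\<^sub>R q) = P *\<^sub>R ((1 / P) *\<^sub>R p + ((l - 1) / M) *\<^sub>R c)" by simp
  then have "(l * P / Q) *\<^sub>R q = p + ((l - 1) * P / M) *\<^sub>R c"
    using PQM by (simp add: scaleR_add_right mult.commute)
  then have "(l * P / Q) *\<^sub>R q = p + (l * P / Q - 1) *\<^sub>R c" unfolding l' .
  moreover have "0 \<le> (l - 1) * P / M" using c(3) PQM by simp
  then have "1 \<le> l * P / Q" using l' by simp
  ultimately show ?thesis using c(1) unfolding reach_def P_def Q_def by auto
qed

text \<open>
  The projective invariance of the Hilbert metric: the two ratios are multiplied by inverse factors.
\<close>

theorem hilbert_near_proj:
  assumes pos: "\<And>c. c \<in> C \<Longrightarrow> 0 < a \<bullet> c + b" and p: "p \<in> C" and q: "q \<in> C"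
  shows "hilbert_near (proj a b ` C) k (proj a b p) (proj a b q) \<longleftrightarrow> hilbert_near C k p q"
proof -
  have PQ: "0 < a \<bullet> p + b" "0 < a \<bullet> q + b" using pos p q by auto
  show ?thesis
  proof
    assume "hilbert_near (proj a b ` C) k (proj a b p) (proj a b q)"
    then obtain l m where lm: "l * m \<le> k" "reach (proj a b ` C) l (proj a b p) (proj a b q)"
      "reach (proj a b ` C) m (proj a b q) (proj a b p)" unfolding hilbert_near_def by auto
    show "hilbert_near C k p q"
      by (rule hilbert_nearI[OF reach_unproj[OF pos p q lm(2)] reach_unproj[OF pos q p lm(3)]])
        (use lm(1) PQ in auto)
  next
    assume "hilbert_near C k p q"
    then obtain l m where lm: "l * m \<le> k" "reach C l p q" "reach C m q p" unfolding hilbert_near_def by auto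
    show "hilbert_near (proj a b ` C) k (proj a b p) (proj a b q)"
      by (rule hilbert_nearI[OF reach_proj[OF pos p q lm(2)] reach_proj[OF pos q p lm(3)]])
        (use lm(1) PQ in auto)
  qed
qed

text \<open>
  The image is the intersection of a hyperplane with the open cone over \<open>C\<close>; this identifies its affine hull and shows that it is
  relatively open.
\<close>

lemma proj_image_eq:
  assumes pos: "\<And>c. c \<in> C \<Longrightarrow> 0 < a \<bullet> c + b"
  shows "proj a b ` C = {u. (a, b) \<bullet> u = 1} \<inter> ({u. 0 < snd u} \<inter> (\<lambda>u. (1 / snd u) *\<^sub>R fst u) -` C)"
    (is "_ = ?H \<inter> ?K")
proof
  show "proj a b ` C \<subseteq> ?H \<inter> ?K"
  proof
    fix u assume "u \<in> proj a b ` C"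
    then obtain y where y: "y \<in> C" "u = proj a b y" by auto
    have m: "0 < a \<bullet> y + b" using pos[OF y(1)] .
    have "(a, b) \<bullet> u = (1 / (a \<bullet> y + b)) * (a \<bullet> y + b)"
      unfolding y(2) by (simp only: inner_prod_def fst_proj snd_proj distrib_left fst_conv snd_conv) simp
    then have "(a, b) \<bullet> u = 1" using m by simp
    moreover have "0 < snd u" using m unfolding y(2) snd_proj by simp
    ultimately show "u \<in> ?H \<inter> ?K" using inverse_proj[OF m] y by simp
  qed
  show "?H \<inter> ?K \<subseteq> proj a b ` C"
  proof
    fix u assume u: "u \<in> ?H \<inter> ?K"
    obtain v s where vs: "u = (v, s)" by (cases u)
    have s: "s > 0" "(1 / s) *\<^sub>R v \<in> C" "a \<bullet> v + b * s = 1" using u unfolding vs by auto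
    have "s * (a \<bullet> ((1 / s) *\<^sub>R v) + b) = 1" using s by (simp add: distrib_left mult.commute)
    then have "1 / (a \<bullet> ((1 / s) *\<^sub>R v) + b) = s" using s(1) by (metis nonzero_eq_divide_eq mult_zero_right zero_neq_one)
    then have "proj a b ((1 / s) *\<^sub>R v) = u" unfolding proj_def vs using s(1) by simp
    then show "u \<in> proj a b ` C" using s(2) by auto
  qed
qed

lemma convex_proj_image:
  assumes C: "convex C" and pos: "\<And>c. c \<in> C \<Longrightarrow> 0 < a \<bullet> c + b"
  shows "convex (proj a b ` C)"
proof (rule convexI)
  fix u v and s t :: real
  assume uv: "u \<in> proj a b ` C" "v \<in> proj a b ` C" and st: "0 \<le> s" "0 \<le> t" "s + t = 1"
  obtain y z where y: "y \<in> C" "u = proj a b y" and z: "z \<in> C" "v = proj a b z" using uv by auto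
  have m: "0 < a \<bullet> y + b" "0 < a \<bullet> z + b" using pos y z by auto
  define \<alpha> \<beta> where "\<alpha> = s / (a \<bullet> y + b)" and "\<beta> = t / (a \<bullet> z + b)"
  have nn: "0 \<le> \<alpha>" "0 \<le> \<beta>" unfolding \<alpha>_def \<beta>_def using st m by auto
  obtain w where w: "w \<in> C" "\<alpha> *\<^sub>R y + \<beta> *\<^sub>R z = (\<alpha> + \<beta>) *\<^sub>R w"
    using convex_weighted[OF C y(1) z(1) nn] by auto
  have "\<alpha> * (a \<bullet> y + b) + \<beta> * (a \<bullet> z + b) = (\<alpha> + \<beta>) * (a \<bullet> w + b)"
    using arg_cong[OF w(2), of "\<lambda>v. a \<bullet> v"] by (simp add: inner_add_right algebra_simps)
  then have "1 = (\<alpha> + \<beta>) * (a \<bullet> w + b)" unfolding \<alpha>_def \<beta>_def using m st by simp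
  then have ab: "\<alpha> + \<beta> = 1 / (a \<bullet> w + b)" using pos[OF w(1)] by (simp add: field_simps)
  have "s *\<^sub>R u + t *\<^sub>R v = (\<alpha> *\<^sub>R y + \<beta> *\<^sub>R z, \<alpha> + \<beta>)"
    unfolding y(2) z(2) proj_def \<alpha>_def \<beta>_def by simp
  also have "\<dots> = proj a b w" unfolding w(2) ab proj_def by simp
  finally show "s *\<^sub>R u + t *\<^sub>R v \<in> proj a b ` C" using w(1) by auto
qed

text \<open>
  Since the affine function dominates the norm, \<open>C\<close> has a bounded image even if \<open>C\<close> is unbounded; passing to the closure adds
  the points at infinity.
\<close>

lemma proj_section:
  fixes C :: "'a::euclidean_space set"
  assumes C: "open C" "convex C" "C \<noteq> {}" and dom: "\<And>y. y \<in> C \<Longrightarrow> norm y + 1 \<le> a \<bullet> y + b"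
  defines "D \<equiv> closure (proj a b ` C)"
  shows "convex D" "compact D" "rel_interior D = proj a b ` C" "aff_dim D = DIM('a)"
proof -
  have pos: "0 < a \<bullet> y + b" if "y \<in> C" for y using dom[OF that] norm_ge_zero[of y] by linarith
  let ?H = "{u. (a, b) \<bullet> u = 1}"
  let ?K = "{u :: 'a \<times> real. 0 < snd u} \<inter> (\<lambda>u. (1 / snd u) *\<^sub>R fst u) -` C"
  have eq: "proj a b ` C = ?H \<inter> ?K" by (rule proj_image_eq[OF pos])
  have cv: "convex (proj a b ` C)" by (rule convex_proj_image[OF C(2) pos])
  then show "convex D" unfolding D_def by (rule convex_closure)
  have "norm u \<le> 1" if "u \<in> proj a b ` C" for u
  proof -
    from that obtain y where y: "y \<in> C" "u = proj a b y" by auto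
    have "norm (y, 1::real) \<le> norm y + 1" using norm_Pair_le[of y "1::real"] by simp
    then have "norm (y, 1::real) \<le> a \<bullet> y + b" using dom[OF y(1)] by linarith
    moreover have "norm u = \<bar>1 / (a \<bullet> y + b)\<bar> * norm (y, 1::real)"
      unfolding y(2) proj_def by (rule norm_scaleR)
    ultimately show ?thesis using pos[OF y(1)] by simp
  qed
  then have "bounded (proj a b ` C)" by (rule boundedI)
  then show "compact D" unfolding D_def by simp
  have opK: "open ?K"
  proof (rule continuous_open_preimage[OF _ _ C(1)])
    show "continuous_on {u :: 'a \<times> real. 0 < snd u} (\<lambda>u. (1 / snd u) *\<^sub>R fst u)"
      by (intro continuous_intros) auto
    show "open {u :: 'a \<times> real. 0 < snd u}" by (intro open_Collect_less continuous_intros)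
  qed
  have ne: "?H \<inter> ?K \<noteq> {}" using C(3) eq by auto
  have hull: "affine hull (?H \<inter> ?K) = ?H"
    using affine_hull_affine_Int_open[OF affine_hyperplane opK ne] affine_hyperplane[of "(a, b)" 1]
    by (simp only: affine_hull_eq[THEN iffD2])
  have "openin (top_of_set ?H) (?H \<inter> ?K)" using opK by (rule openin_open_Int)
  then have "rel_interior (?H \<inter> ?K) = ?H \<inter> ?K" unfolding rel_interior_eq hull .
  moreover have "rel_interior D = rel_interior (proj a b ` C)"
    unfolding D_def by (rule convex_rel_interior_closure[OF cv])
  ultimately show "rel_interior D = proj a b ` C" by (simp only: eq)
  have "(a, b) \<noteq> 0"
  proof
    assume ab0: "(a, b) = 0"
    obtain u where "u \<in> ?H \<inter> ?K" using ne by auto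
    then show False unfolding ab0 by simp
  qed
  then have "aff_dim ?H = DIM('a)" using aff_dim_hyperplane[of "(a, b)" 1] by (simp del: aff_dim_hyperplane)
  then have "aff_dim (?H \<inter> ?K) = DIM('a)"
    using aff_dim_affine_hull[of "?H \<inter> ?K"] unfolding hull by simp
  then show "aff_dim D = DIM('a)" unfolding D_def eq by simp
qed

text \<open>
  A witness in the closure is moved into \<open>A\<close> by mixing it with \<open>q\<close>, at the price of doubling the ratio.
\<close>

lemma reach_closure:
  fixes A :: "'a::euclidean_space set"
  assumes A: "convex A" and l: "reach (closure A) l p q" and q: "q \<in> rel_interior A"
  shows "reach A (2 * l) p q"
proof -
  obtain c where c: "c \<in> closure A" "l *\<^sub>R q = p + (l - 1) *\<^sub>R c" "1 \<le> l"
    using l unfolding reach_def by auto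
  define e where "e = l / (2 * l - 1)"
  have e: "0 < e" "e \<le> 1" unfolding e_def using c(3) by auto
  have "c - e *\<^sub>R (c - q) \<in> rel_interior A"
    by (rule rel_interior_closure_convex_shrink[OF A q c(1) e])
  then have w: "c - e *\<^sub>R (c - q) \<in> A" using rel_interior_subset by auto
  have "(2 * l - 1) * e = l" unfolding e_def using c(3) by simp
  then have "(2 * l - 1) *\<^sub>R (c - e *\<^sub>R (c - q)) = (2 * l - 1) *\<^sub>R c - l *\<^sub>R (c - q)"
    by (simp add: scaleR_diff_right)
  also have "(2 * l - 1) *\<^sub>R c = (l - 1) *\<^sub>R c + l *\<^sub>R c" by (simp add: scaleR_add_left[symmetric])
  also have "(l - 1) *\<^sub>R c + l *\<^sub>R c - l *\<^sub>R (c - q) = (l - 1) *\<^sub>R c + l *\<^sub>R q"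
    by (simp add: scaleR_diff_right)
  finally have "p + (2 * l - 1) *\<^sub>R (c - e *\<^sub>R (c - q)) = (p + (l - 1) *\<^sub>R c) + l *\<^sub>R q" by simp
  also have "\<dots> = (2 * l) *\<^sub>R q" unfolding c(2)[symmetric] by (simp add: scaleR_add_left[symmetric])
  finally show ?thesis unfolding reach_def using c(3) by (intro conjI bexI[OF _ w]) simp_all
qed

lemma hilbert_near_rel_interior:
  fixes D :: "'a::euclidean_space set"
  assumes D: "convex D" "p \<in> rel_interior D" "hilbert_near D k p q"
  shows "q \<in> rel_interior D"
proof -
  obtain l c where c: "c \<in> D" "l *\<^sub>R q = p + (l - 1) *\<^sub>R c" "1 \<le> l"
    using D(3) unfolding hilbert_near_def reach_def by auto
  have "(1 / l) *\<^sub>R (l *\<^sub>R q) = (1 / l) *\<^sub>R (p + (l - 1) *\<^sub>R c)" unfolding c(2) ..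
  then have "q = (1 / l) *\<^sub>R p + (1 - 1 / l) *\<^sub>R c"
    using c(3) by (simp add: scaleR_add_right diff_divide_distrib)
  then have "q = c - (1 / l) *\<^sub>R (c - p)" by (simp add: algebra_simps)
  moreover have "c - (1 / l) *\<^sub>R (c - p) \<in> rel_interior D"
    using c(3) by (intro rel_interior_convex_shrink[OF D(1,2) c(1)]) auto
  ultimately show ?thesis by simp
qed

text \<open>
  Points that are close to a relative interior point belong to the relative interior, so a packing of the compact image
  consists of images of points of \<open>C\<close>.
\<close>

lemma packing_unproj:
  fixes C :: "'a::euclidean_space set"
  assumes C: "open C" "convex C" "x \<in> C" and dom: "\<And>y. y \<in> C \<Longrightarrow> norm y + 1 \<le> a \<bullet> y + b"
    and S: "packing (closure (proj a b ` C)) K (proj a b x) S"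
  shows "\<exists>T. packing C (4 * K) x T \<and> card T = card S"
proof -
  let ?A = "proj a b ` C" and ?D = "closure (proj a b ` C)"
  have ne: "C \<noteq> {}" using C(3) by auto
  note D = proj_section[OF C(1,2) ne dom]
  have pos: "0 < a \<bullet> y + b" if "y \<in> C" for y using dom[OF that] norm_ge_zero[of y] by linarith
  have cv: "convex ?A" by (rule convex_proj_image[OF C(2) pos])
  have ri: "rel_interior ?A = ?A" using D(3) convex_rel_interior_closure[OF cv] by simp
  have xA: "proj a b x \<in> ?A" using C(3) by simp
  have SA: "S \<subseteq> ?A"
  proof
    fix u assume "u \<in> S"
    then show "u \<in> ?A"
      using hilbert_near_rel_interior[OF D(1) _ packingD(3)[OF S]] D(3) xA by simp
  qed
  define T where "T = {y \<in> C. proj a b y \<in> S}"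
  have inj: "inj_on (proj a b) C"
    by (rule inj_on_inverseI[of _ "\<lambda>u. (1 / snd u) *\<^sub>R fst u"]) (rule inverse_proj[OF pos])
  have img: "proj a b ` T = S" unfolding T_def using SA by auto
  have inj': "inj_on (proj a b) T" by (rule inj_on_subset[OF inj]) (simp add: T_def)
  have "packing C (4 * K) x T"
  proof (rule packingI)
    show "finite T" using finite_imageD[OF _ inj'] packingD(1)[OF S] unfolding img by simp
    show "T \<subseteq> C" unfolding T_def by auto
  next
    fix y assume "y \<in> T"
    then have y: "y \<in> C" "proj a b y \<in> S" unfolding T_def by auto
    obtain l m where lm: "l * m \<le> K" "reach ?D l (proj a b x) (proj a b y)" "reach ?D m (proj a b y) (proj a b x)"
      using packingD(3)[OF S y(2)] unfolding hilbert_near_def by auto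
    have yA: "proj a b y \<in> rel_interior ?A" "proj a b x \<in> rel_interior ?A" unfolding ri using y(1) xA by auto
    have "hilbert_near ?A (4 * K) (proj a b x) (proj a b y)"
      by (rule hilbert_nearI[OF reach_closure[OF cv lm(2) yA(1)] reach_closure[OF cv lm(3) yA(2)]]) (use lm(1) in simp)
    then show "hilbert_near C (4 * K) x y" using hilbert_near_proj[OF pos C(3) y(1)] by simp
  next
    fix y z assume yz: "y \<in> T" "z \<in> T" "y \<noteq> z"
    then have yz': "y \<in> C" "z \<in> C" "proj a b y \<in> S" "proj a b z \<in> S" unfolding T_def by auto
    have ne: "proj a b y \<noteq> proj a b z" using inj_onD[OF inj _ yz'(1,2)] yz(3) by auto
    show "\<not> hilbert_near C 16 y z"
    proof
      assume "hilbert_near C 16 y z"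
      then have "hilbert_near ?A 16 (proj a b y) (proj a b z)" using hilbert_near_proj[OF pos yz'(1,2)] by simp
      then have "hilbert_near ?D 16 (proj a b y) (proj a b z)" by (rule hilbert_near_subset[OF _ closure_subset])
      then show False using packingD(4)[OF S yz'(3,4) ne] by simp
    qed
  qed
  moreover have "card T = card S" using card_image[OF inj'] unfolding img by simp
  ultimately show ?thesis by auto
qed

text \<open>
  A linear inequality for the image becomes, after multiplication with the positive affine function, an affine inequality for
  \<open>C\<close>.  Positivity of that function has to be added to the list of inequalities.
\<close>

lemma polytope_section_imp_open_polytope:
  fixes C :: "(real ^ 'n) set"
  assumes C: "open C" "convex C" "C \<noteq> {}" and dom: "\<And>y. y \<in> C \<Longrightarrow> norm y + 1 \<le> a \<bullet> y + b"
    and poly: "polytope (closure (proj a b ` C))"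
  shows "open_polytope C"
proof -
  let ?D = "closure (proj a b ` C)"
  have pos: "0 < a \<bullet> y + b" if "y \<in> C" for y using dom[OF that] norm_ge_zero[of y] by linarith
  obtain F where F: "finite F" "?D = \<Inter> F" "\<forall>h\<in>F. \<exists>f c. f \<noteq> 0 \<and> h = {u. f \<bullet> u \<le> c}"
    using polytope_imp_polyhedron[OF poly] unfolding polyhedron_def by auto
  have "\<forall>h\<in>F. \<exists>fc. h = {u. fst fc \<bullet> u \<le> snd fc}" using F(3) by (metis fst_conv snd_conv)
  then obtain g where g: "\<forall>h\<in>F. h = {u. fst (g h) \<bullet> u \<le> snd (g h)}" by (rule bchoice[THEN exE])
  define Q where "Q h = {y. (fst (fst (g h)) - snd (g h) *\<^sub>R a) \<bullet> y \<le> snd (g h) * b - snd (fst (g h))}" for h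
  have Q: "y \<in> Q h \<longleftrightarrow> proj a b y \<in> h" if "h \<in> F" "0 < a \<bullet> y + b" for h y
  proof -
    have "fst (g h) \<bullet> proj a b y = (fst (fst (g h)) \<bullet> y + snd (fst (g h))) / (a \<bullet> y + b)"
      by (simp add: inner_prod_def fst_proj snd_proj add_divide_distrib)
    moreover have "h = {u. fst (g h) \<bullet> u \<le> snd (g h)}" using g that(1) by (rule bspec)
    from eqset_imp_iff[OF this, of "proj a b y"]
    have "proj a b y \<in> h \<longleftrightarrow> fst (g h) \<bullet> proj a b y \<le> snd (g h)" by simp
    ultimately have "proj a b y \<in> h \<longleftrightarrow> fst (fst (g h)) \<bullet> y + snd (fst (g h)) \<le> snd (g h) * (a \<bullet> y + b)"
      using that(2) by (simp add: pos_divide_le_eq)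
    also have "\<dots> \<longleftrightarrow> y \<in> Q h" unfolding Q_def by (auto simp: inner_diff_left algebra_simps)
    finally show ?thesis by simp
  qed
  define P where "P = {y. (- a) \<bullet> y \<le> b} \<inter> \<Inter> (Q ` F)"
  have "polyhedron P"
    unfolding P_def Q_def using F(1)
    by (intro polyhedron_Int polyhedron_Inter polyhedron_halfspace_le) (auto intro: polyhedron_halfspace_le)
  moreover have "interior P = C"
  proof
    have "C \<subseteq> P"
    proof
      fix y assume y: "y \<in> C"
      have "proj a b y \<in> ?D" using y closure_subset[of "proj a b ` C"] by auto
      then have "y \<in> Q h" if "h \<in> F" for h using Q[OF that pos[OF y]] F(2) that by auto
      then show "y \<in> P" using pos[OF y] unfolding P_def by auto
    qed
    then show "C \<subseteq> interior P" by (rule interior_maximal[OF _ C(1)])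
    have "interior P \<subseteq> closure C"
    proof
      fix y assume y: "y \<in> interior P"
      then have yP: "y \<in> P" using interior_subset by auto
      have m: "0 < a \<bullet> y + b"
      proof (cases "a = 0")
        case True
        then show ?thesis using C(3) pos by auto
      next
        case False
        obtain e where e: "e > 0" "cball y e \<subseteq> P" using y unfolding mem_interior_cball by auto
        have "y - (e / norm a) *\<^sub>R a \<in> P" using e False by (intro subsetD[OF e(2)]) (simp add: dist_norm)
        then have "0 \<le> a \<bullet> (y - (e / norm a) *\<^sub>R a) + b" unfolding P_def by auto
        then have "(e / norm a) * (a \<bullet> a) \<le> a \<bullet> y + b" by (simp only: inner_diff_right inner_scaleR_right)
        moreover have "0 < (e / norm a) * (a \<bullet> a)" using e(1) False by simp
        ultimately show ?thesis by linarith
      qed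
      have "proj a b y \<in> ?D" unfolding F(2) using yP Q[OF _ m] unfolding P_def by auto
      then obtain u where u: "\<And>n. u n \<in> proj a b ` C" "u \<longlonglongrightarrow> proj a b y"
        unfolding closure_sequential by auto
      have "(\<lambda>n. (1 / snd (u n)) *\<^sub>R fst (u n)) \<longlonglongrightarrow> (1 / snd (proj a b y)) *\<^sub>R fst (proj a b y)"
        using m by (intro tendsto_intros u(2)) (simp add: snd_proj)
      then have "(\<lambda>n. (1 / snd (u n)) *\<^sub>R fst (u n)) \<longlonglongrightarrow> y" unfolding inverse_proj[OF m] .
      moreover have "(1 / snd (u n)) *\<^sub>R fst (u n) \<in> C" for n
      proof -
        obtain z where "z \<in> C" "u n = proj a b z" using u(1)[of n] by auto
        then show ?thesis using inverse_proj[OF pos] by simp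
      qed
      ultimately show "y \<in> closure C" unfolding closure_sequential by (intro exI conjI allI)
    qed
    then have "interior P \<subseteq> interior (closure C)" by (intro interior_maximal) auto
    then show "interior P \<subseteq> C" using convex_interior_closure[OF C(2)] C(1) by (simp add: interior_open)
  qed
  ultimately show ?thesis unfolding open_polytope_def by auto
qed

section \<open>Balls of polyhedral Hilbert geometries\<close>

text \<open>
  Choose the basis with the largest determinant.  By Cramer's rule each coefficient is a quotient of two determinants, the
  numerator belonging to the basis with one vector exchanged.
\<close>

lemma spanning_family_dominating_basis:
  fixes u :: "'f \<Rightarrow> real ^ 'n"
  assumes F: "finite F" and span: "span (u ` F) = UNIV"
  shows "\<exists>\<sigma>. (\<forall>j. \<sigma> j \<in> F) \<and>
           (\<forall>f\<in>F. \<exists>c :: real ^ 'n. u f = (\<Sum>j\<in>UNIV. c $ j *\<^sub>R u (\<sigma> j)) \<and> (\<forall>j. \<bar>c $ j\<bar> \<le> 1))"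
proof -
  define M where "M \<sigma> = (\<chi> i j. u (\<sigma> j) $ i)" for \<sigma> :: "'n \<Rightarrow> 'f"
  define \<Sigma> where "\<Sigma> = (UNIV :: 'n set) \<rightarrow>\<^sub>E F"
  have fin: "finite \<Sigma>" unfolding \<Sigma>_def using F by (intro finite_PiE) auto
  have mem: "\<sigma> \<in> \<Sigma> \<longleftrightarrow> (\<forall>j. \<sigma> j \<in> F)" for \<sigma> unfolding \<Sigma>_def by (auto simp: PiE_def)
  have "\<exists>\<sigma>\<in>\<Sigma>. det (M \<sigma>) \<noteq> 0"
  proof -
    obtain B where B: "B \<subseteq> u ` F" "independent B" "u ` F \<subseteq> span B" "card B = dim (u ` F)"
      by (rule basis_exists)
    have spB: "span B = UNIV" using span_mono[OF B(3)] span by (simp add: span_span top.extremum_unique)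
    have "dim (u ` F) = CARD('n)" using span dim_eq_full[of "u ` F"] by simp
    then have "card B = CARD('n)" using B(4) by simp
    moreover have "finite B" using finite_subset[OF B(1)] F by simp
    ultimately obtain h where h: "bij_betw h (UNIV :: 'n set) B"
      using finite_same_card_bij[of "UNIV :: 'n set" B] by auto
    have "\<forall>j. \<exists>f. f \<in> F \<and> u f = h j"
    proof
      fix j
      have "h j \<in> u ` F" using h B(1) unfolding bij_betw_def by auto
      then show "\<exists>f. f \<in> F \<and> u f = h j" by auto
    qed
    then obtain \<sigma> where \<sigma>: "\<forall>j. \<sigma> j \<in> F \<and> u (\<sigma> j) = h j" by (rule choice[THEN exE])
    have col: "column j (M \<sigma>) = h j" for j unfolding column_def M_def using \<sigma> by (simp add: vec_eq_iff)
    have "columns (M \<sigma>) = B"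
      unfolding columns_def col using h unfolding bij_betw_def by auto
    then have "\<exists>A'. M \<sigma> ** A' = mat 1"
      using matrix_right_invertible_span_columns[of "M \<sigma>"] spB by (simp add: span_vec_eq)
    then have "det (M \<sigma>) \<noteq> 0" using invertible_right_inverse[of "M \<sigma>"] invertible_det_nz[of "M \<sigma>"] by simp
    then show ?thesis using \<sigma> mem by auto
  qed
  then obtain \<tau> where \<tau>: "\<tau> \<in> \<Sigma>" "det (M \<tau>) \<noteq> 0" by auto
  have "Max ((\<lambda>\<sigma>. \<bar>det (M \<sigma>)\<bar>) ` \<Sigma>) \<in> (\<lambda>\<sigma>. \<bar>det (M \<sigma>)\<bar>) ` \<Sigma>"
    using fin \<tau>(1) by (intro Max_in) auto
  then obtain \<sigma> where \<sigma>: "\<sigma> \<in> \<Sigma>" "\<bar>det (M \<sigma>)\<bar> = Max ((\<lambda>\<sigma>. \<bar>det (M \<sigma>)\<bar>) ` \<Sigma>)" by auto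
  have max: "\<bar>det (M \<rho>)\<bar> \<le> \<bar>det (M \<sigma>)\<bar>" if "\<rho> \<in> \<Sigma>" for \<rho>
    unfolding \<sigma>(2) using fin that by (intro Max_ge) auto
  have nz: "det (M \<sigma>) \<noteq> 0" using max[OF \<tau>(1)] \<tau>(2) by auto
  have "\<exists>c :: real ^ 'n. u f = (\<Sum>j\<in>UNIV. c $ j *\<^sub>R u (\<sigma> j)) \<and> (\<forall>j. \<bar>c $ j\<bar> \<le> 1)" if f: "f \<in> F" for f
  proof -
    define c where "c = (\<chi> k. det (\<chi> i j. if j = k then u f $ i else M \<sigma> $ i $ j) / det (M \<sigma>))"
    have "M \<sigma> *v c = u f" using cramer[OF nz, of c "u f"] unfolding c_def by simp
    then have "u f = (\<Sum>j\<in>UNIV. c $ j *\<^sub>R u (\<sigma> j))"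
      by (auto simp: vec_eq_iff matrix_vector_mult_def M_def mult.commute)
    moreover have "\<bar>c $ k\<bar> \<le> 1" for k
    proof -
      have "(\<chi> i j. if j = k then u f $ i else M \<sigma> $ i $ j) = M (\<sigma>(k := f))"
        unfolding M_def by (simp add: vec_eq_iff)
      then have "c $ k = det (M (\<sigma>(k := f))) / det (M \<sigma>)" unfolding c_def by simp
      moreover have "\<sigma>(k := f) \<in> \<Sigma>" using \<sigma>(1) f mem by simp
      ultimately show ?thesis using max nz by (simp add: abs_divide divide_le_eq_1)
    qed
    ultimately show ?thesis by auto
  qed
  then show ?thesis using \<sigma>(1) mem by auto
qed

lemma open_polytope_halfspaces:
  assumes "open_polytope C"
  obtains F where "finite F" "C = {y. \<forall>f\<in>F. 0 < fst f \<bullet> y + snd f}"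
proof -
  obtain P where P: "polyhedron P" "C = interior P" using assms unfolding open_polytope_def by auto
  obtain G where G: "finite G" "P = \<Inter> G" "\<forall>h\<in>G. \<exists>f c. f \<noteq> 0 \<and> h = {u. f \<bullet> u \<le> c}"
    using P(1) unfolding polyhedron_def by auto
  have "\<forall>h\<in>G. \<exists>fc. fst fc \<noteq> 0 \<and> h = {u. 0 \<le> fst fc \<bullet> u + snd fc}"
  proof
    fix h assume "h \<in> G"
    then obtain f c where "f \<noteq> 0" "h = {u. f \<bullet> u \<le> c}" using G(3) by auto
    then show "\<exists>fc. fst fc \<noteq> 0 \<and> h = {u. 0 \<le> fst fc \<bullet> u + snd fc}"
      by (intro exI[of _ "(- f, c)"]) auto
  qed
  then obtain g where g: "\<forall>h\<in>G. fst (g h) \<noteq> 0 \<and> h = {u. 0 \<le> fst (g h) \<bullet> u + snd (g h)}"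
    by (rule bchoice[THEN exE])
  have "C = {y. \<forall>f\<in>g ` G. 0 < fst f \<bullet> y + snd f}" (is "_ = ?R")
  proof
    show "C \<subseteq> ?R"
    proof
      fix y assume y: "y \<in> C"
      have "0 < fst (g h) \<bullet> y + snd (g h)" if h: "h \<in> G" for h
      proof -
        have nz: "fst (g h) \<noteq> 0" and eq: "h = {u. 0 \<le> fst (g h) \<bullet> u + snd (g h)}" using g h by auto
        have "h = {u. - snd (g h) \<le> fst (g h) \<bullet> u}" by (subst eq) auto
        then have "interior h = interior {u. - snd (g h) \<le> fst (g h) \<bullet> u}" by (rule arg_cong)
        also have "\<dots> = {u. - snd (g h) < fst (g h) \<bullet> u}" by (rule interior_halfspace_ge[OF nz])
        finally have "interior h = {u. - snd (g h) < fst (g h) \<bullet> u}" .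
        moreover have "interior P \<subseteq> interior h" unfolding G(2) using h by (intro interior_mono) auto
        ultimately show ?thesis using y unfolding P(2) by auto
      qed
      then show "y \<in> ?R" by auto
    qed
    have "?R = (\<Inter>f\<in>g ` G. {y. 0 < fst f \<bullet> y + snd f})" by auto
    moreover have "open (\<Inter>f\<in>g ` G. {y. 0 < fst f \<bullet> y + snd f})"
      using G(1) by (intro open_INT ballI open_Collect_less continuous_intros) simp
    ultimately have "open ?R" by simp
    moreover have "?R \<subseteq> P"
    proof
      fix y assume y: "y \<in> ?R"
      have "y \<in> h" if h: "h \<in> G" for h
      proof -
        have eq: "h = {u. 0 \<le> fst (g h) \<bullet> u + snd (g h)}" using g h by auto
        have "0 < fst (g h) \<bullet> y + snd (g h)" using y h by auto
        then show ?thesis by (subst eq) simp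
      qed
      then show "y \<in> P" unfolding G(2) by auto
    qed
    ultimately show "?R \<subseteq> C" unfolding P(2) by (intro interior_maximal)
  qed
  then show ?thesis using that[of "g ` G"] G(1) by simp
qed

text \<open>
  Throughout, \<open>C\<close> is the intersection of finitely many open half spaces, encoded as pairs of a normal vector and a constant.
\<close>

context
  fixes F :: "((real ^ 'n) \<times> real) set" and C :: "(real ^ 'n) set"
  assumes C: "hilbert_geometry C" and F: "finite F"
    and CF: "C = {y. \<forall>f\<in>F. 0 < fst f \<bullet> y + snd f}"
begin

definition slack :: "(real ^ 'n) \<times> real \<Rightarrow> real ^ 'n \<Rightarrow> real" where
  "slack f y = fst f \<bullet> y + snd f"

lemma slack_pos: "y \<in> C \<Longrightarrow> f \<in> F \<Longrightarrow> 0 < slack f y"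
  using CF unfolding slack_def by auto

lemma mem_if_slack_pos: "(\<And>f. f \<in> F \<Longrightarrow> 0 < slack f y) \<Longrightarrow> y \<in> C"
  using CF unfolding slack_def by auto

lemma normals_span: "span (fst ` F) = UNIV"
proof (rule ccontr)
  assume "span (fst ` F) \<noteq> UNIV"
  then obtain v where v: "v \<noteq> 0" "\<forall>x\<in>span (fst ` F). v \<bullet> x = 0" using span_not_UNIV_orthogonal by metis
  obtain p where p: "p \<in> C" using hilbert_geometryD(3)[OF C] by auto
  have "p + t *\<^sub>R v \<in> C" for t :: real
  proof (rule mem_if_slack_pos)
    fix f assume f: "f \<in> F"
    then have "v \<bullet> fst f = 0" using v(2) span_base[of "fst f" "fst ` F"] by auto
    then have "slack f (p + t *\<^sub>R v) = slack f p" unfolding slack_def by (simp add: inner_add_right inner_commute)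
    then show "0 < slack f (p + t *\<^sub>R v)" using slack_pos[OF p f] by simp
  qed
  then show False using C v(1) unfolding hilbert_geometry_def by auto
qed

text \<open>
  Scaling the normals by the values of the half space functions at \<open>p\<close> turns the symmetric body at \<open>p\<close> into the set on which all
  functionals of a spanning family have absolute value below one.  By the choice of the basis it contains a parallelepiped given by
  only \<open>n\<close> of them.
\<close>

lemma dominating_normals:
  assumes p: "p \<in> C"
  shows "\<exists>\<sigma>. (\<forall>j :: 'n. \<sigma> j \<in> F) \<and>
    (\<forall>v. (\<forall>j. \<bar>fst (\<sigma> j) \<bullet> v\<bar> < slack (\<sigma> j) p / CARD('n)) \<longrightarrow> v \<in> sym_body C p)"
proof -
  define u where "u f = (1 / slack f p) *\<^sub>R fst f" for f
  have sp: "span (u ` F) = UNIV"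
  proof -
    have "fst ` F \<subseteq> span (u ` F)"
    proof
      fix w assume "w \<in> fst ` F"
      then obtain f where f: "f \<in> F" "w = fst f" by auto
      have "w = slack f p *\<^sub>R u f" unfolding u_def f(2) using slack_pos[OF p f(1)] by simp
      then show "w \<in> span (u ` F)" using span_scale[OF span_base[of "u f" "u ` F"]] f(1) by simp
    qed
    then have "span (fst ` F) \<subseteq> span (u ` F)" by (rule span_minimal[OF _ subspace_span])
    then show ?thesis using normals_span by auto
  qed
  obtain \<sigma> where \<sigma>: "\<forall>j. \<sigma> j \<in> F"
    "\<forall>f\<in>F. \<exists>c :: real ^ 'n. u f = (\<Sum>j\<in>UNIV. c $ j *\<^sub>R u (\<sigma> j)) \<and> (\<forall>j. \<bar>c $ j\<bar> \<le> 1)"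
    using spanning_family_dominating_basis[OF F sp] by auto
  show ?thesis
  proof (intro exI[of _ \<sigma>] conjI allI impI)
    show "\<sigma> j \<in> F" for j using \<sigma>(1) by simp
    fix v assume v': "\<forall>j. \<bar>fst (\<sigma> j) \<bullet> v\<bar> < slack (\<sigma> j) p / CARD('n)"
    have v: "\<bar>fst (\<sigma> j) \<bullet> v\<bar> < slack (\<sigma> j) p / CARD('n)" for j using v' by simp
    have uv: "\<bar>u (\<sigma> j) \<bullet> v\<bar> < 1 / CARD('n)" for j
    proof -
      have pos: "0 < slack (\<sigma> j) p" using slack_pos[OF p] \<sigma>(1) by simp
      have "\<bar>u (\<sigma> j) \<bullet> v\<bar> = \<bar>fst (\<sigma> j) \<bullet> v\<bar> / slack (\<sigma> j) p" unfolding u_def using pos by (simp add: abs_divide)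
      then show ?thesis using divide_strict_right_mono[OF v[of j] pos] pos by simp
    qed
    have small: "\<bar>fst f \<bullet> v\<bar> < slack f p" if f: "f \<in> F" for f
    proof -
      obtain c :: "real ^ 'n" where c: "u f = (\<Sum>j\<in>UNIV. c $ j *\<^sub>R u (\<sigma> j))" "\<forall>j. \<bar>c $ j\<bar> \<le> 1"
        using \<sigma>(2) f by auto
      have "\<bar>u f \<bullet> v\<bar> = \<bar>\<Sum>j\<in>UNIV. c $ j * (u (\<sigma> j) \<bullet> v)\<bar>" unfolding c(1) by (simp add: inner_sum_left)
      also have "\<dots> \<le> (\<Sum>j\<in>UNIV. \<bar>c $ j * (u (\<sigma> j) \<bullet> v)\<bar>)" by (rule sum_abs)
      also have "\<dots> < (\<Sum>j\<in>(UNIV :: 'n set). 1 / CARD('n))"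
      proof (rule sum_strict_mono)
        fix j :: 'n
        have "\<bar>c $ j * (u (\<sigma> j) \<bullet> v)\<bar> \<le> 1 * \<bar>u (\<sigma> j) \<bullet> v\<bar>"
          unfolding abs_mult using c(2) by (intro mult_right_mono) auto
        then show "\<bar>c $ j * (u (\<sigma> j) \<bullet> v)\<bar> < 1 / CARD('n)" using uv[of j] by simp
      qed auto
      also have "\<dots> = 1" by simp
      finally have "\<bar>fst f \<bullet> v\<bar> / slack f p < 1" unfolding u_def using slack_pos[OF p f] by (simp add: abs_divide)
      then show ?thesis using slack_pos[OF p f] by simp
    qed
    have "p + v \<in> C"
      using small by (intro mem_if_slack_pos) (fastforce simp: slack_def inner_add_right)
    moreover have "p - v \<in> C"
      using small by (intro mem_if_slack_pos) (fastforce simp: slack_def inner_diff_right)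
    ultimately show "v \<in> sym_body C p" unfolding sym_body_def by simp
  qed
qed

text \<open>
  The parallelepipeds of an exponential grid.  In the logarithms of \<open>n\<close> half space functions they are unit cubes.
\<close>

definition cell :: "('n \<Rightarrow> (real ^ 'n) \<times> real) \<Rightarrow> ('n \<Rightarrow> int) \<Rightarrow> (real ^ 'n) set" where
  "cell \<sigma> k = {y. \<forall>j. exp (k j) \<le> slack (\<sigma> j) y \<and> slack (\<sigma> j) y < exp (k j + 1)}"

lemma cell_borel: "cell \<sigma> k \<in> sets borel"
proof -
  have "cell \<sigma> k = (\<Inter>j. {y. exp (k j) \<le> slack (\<sigma> j) y} \<inter> {y. slack (\<sigma> j) y < exp (k j + 1)})"
    unfolding cell_def by auto
  moreover have "{y. exp (k j) \<le> slack (\<sigma> j) y} \<in> sets borel" for j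
    unfolding slack_def by (intro borel_closed closed_Collect_le continuous_intros)
  moreover have "{y. slack (\<sigma> j) y < exp (k j + 1)} \<in> sets borel" for j
    unfolding slack_def by (intro borel_open open_Collect_less continuous_intros)
  ultimately show ?thesis by (simp add: sets.countable_INT' countable_finite)
qed

text \<open>
  Differences of two points of a cell have size comparable to the values of the half space functions at \<open>p\<close>, so a translate of the
  cell fits into a multiple of the Finsler ball at \<open>p\<close>.  The Busemann volume of a cell is therefore bounded, without any
  computation of determinants.
\<close>

lemma cell_volume_le:
  assumes p: "p \<in> C" "p \<in> cell \<sigma> k"
    and dom: "\<forall>v. (\<forall>j. \<bar>fst (\<sigma> j) \<bullet> v\<bar> < slack (\<sigma> j) p / CARD('n)) \<longrightarrow> v \<in> sym_body C p"
  shows "ennreal (1 / (2 * real CARD('n)) ^ CARD('n)) * emeasure lborel (cell \<sigma> k) \<le> emeasure lborel (finsler_ball C p)"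
proof -
  let ?c = "2 * real CARD('n)"
  have borel: "sym_body C p \<in> sets borel"
    using open_sym_body[OF hilbert_geometryD(1)[OF C]] by simp
  have "cell \<sigma> k \<subseteq> (\<lambda>v. p + ?c *\<^sub>R v) ` sym_body C p"
  proof
    fix q assume q: "q \<in> cell \<sigma> k"
    have "(1 / ?c) *\<^sub>R (q - p) \<in> sym_body C p"
    proof (rule dom[rule_format])
      fix j
      \<comment> \<open>two values in the same cell differ by less than twice the smaller one, since \<open>exp 1 \<le> 3\<close>\<close>
      have e: "exp (real_of_int (k j) + 1) \<le> 3 * exp (k j)"
        using exp_le by (simp add: exp_add mult.commute)
      have "\<bar>slack (\<sigma> j) q - slack (\<sigma> j) p\<bar> < 2 * slack (\<sigma> j) p"
      proof -
        have "exp (k j) \<le> slack (\<sigma> j) q" "slack (\<sigma> j) q < 3 * exp (k j)" "exp (k j) \<le> slack (\<sigma> j) p" "slack (\<sigma> j) p < 3 * exp (k j)"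
          using p(2) q e unfolding cell_def by (auto intro: less_le_trans)
        then show ?thesis by linarith
      qed
      moreover have "slack (\<sigma> j) q - slack (\<sigma> j) p = fst (\<sigma> j) \<bullet> (q - p)" unfolding slack_def by (simp add: inner_diff_right)
      ultimately have "\<bar>fst (\<sigma> j) \<bullet> (q - p)\<bar> / ?c < 2 * slack (\<sigma> j) p / ?c"
        by (intro divide_strict_right_mono) auto
      moreover have "fst (\<sigma> j) \<bullet> ((1 / ?c) *\<^sub>R (q - p)) = (fst (\<sigma> j) \<bullet> (q - p)) / ?c"
        by (subst inner_scaleR_right) simp
      ultimately show "\<bar>fst (\<sigma> j) \<bullet> ((1 / ?c) *\<^sub>R (q - p))\<bar> < slack (\<sigma> j) p / CARD('n)"
        by (simp add: abs_divide del: inner_scaleR_right inner_diff_right)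
    qed
    then show "q \<in> (\<lambda>v. p + ?c *\<^sub>R v) ` sym_body C p"
      by (intro image_eqI[of _ _ "(1 / ?c) *\<^sub>R (q - p)"]) auto
  qed
  then have "emeasure lborel (cell \<sigma> k) \<le> emeasure lborel ((\<lambda>v. p + ?c *\<^sub>R v) ` sym_body C p)"
    using emeasure_lborel_affine_image(1)[OF borel, of ?c p] by (intro emeasure_mono) auto
  also have "\<dots> = ennreal ((2 * real CARD('n)) ^ CARD('n)) * emeasure lborel (sym_body C p)"
    using emeasure_lborel_affine_image(2)[OF borel, of ?c p] by simp
  also have "\<dots> \<le> ennreal ((2 * real CARD('n)) ^ CARD('n)) * emeasure lborel (finsler_ball C p)"
    using sym_body_subset_finsler_ball[OF C p(1)] open_finsler_ball[OF C p(1)]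
    by (intro mult_left_mono emeasure_mono) auto
  finally have "ennreal (1 / (2 * real CARD('n)) ^ CARD('n)) * emeasure lborel (cell \<sigma> k) \<le>
      ennreal (1 / (2 * real CARD('n)) ^ CARD('n)) * (ennreal ((2 * real CARD('n)) ^ CARD('n)) * emeasure lborel (finsler_ball C p))"
    by (rule mult_left_mono) simp
  also have "\<dots> = ennreal (1 / (2 * real CARD('n)) ^ CARD('n) * (2 * real CARD('n)) ^ CARD('n)) * emeasure lborel (finsler_ball C p)"
    by (subst ennreal_mult) (simp_all add: mult.assoc)
  also have "1 / (2 * real CARD('n)) ^ CARD('n) * (2 * real CARD('n)) ^ CARD('n) = 1" by simp
  finally show ?thesis by (simp only: ennreal_1 mult_1_left)
qed

text \<open>
  On a ball of radius \<open>r\<close> the logarithm of a positive affine function varies by at most \<open>2 * r\<close> in each direction.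
\<close>

lemma ball_ln_bound:
  assumes x: "x \<in> C"
  obtains B where "B \<ge> 0"
    "\<And>r p f. \<lbrakk>p \<in> hilbert_ball C x r; f \<in> F\<rbrakk> \<Longrightarrow> \<bar>ln (slack f p)\<bar> \<le> B + 2 * r"
proof -
  define B where "B = (\<Sum>f\<in>F. \<bar>ln (slack f x)\<bar>)"
  have B: "\<bar>ln (slack f x)\<bar> \<le> B" if "f \<in> F" for f
    unfolding B_def using F that by (intro member_le_sum) auto
  have "\<bar>ln (slack f p)\<bar> \<le> B + 2 * r" if p: "p \<in> hilbert_ball C x r" and f: "f \<in> F" for r p f
  proof -
    have pC: "p \<in> C" and d: "hilbert_dist C x p < r" using p unfolding hilbert_ball_def by auto
    have ineq: "- snd f < fst f \<bullet> c" if "c \<in> C" for c using slack_pos[OF that f] unfolding slack_def by simp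
    have le: "slack f x \<le> exp (2 * r) * slack f p" "slack f p \<le> exp (2 * r) * slack f x"
      using hilbert_dist_functional[OF C x pC d ineq] unfolding slack_def by simp_all
    have pos: "0 < slack f x" "0 < slack f p" using slack_pos x pC f by auto
    have "ln (slack f x) \<le> ln (exp (2 * r) * slack f p)" "ln (slack f p) \<le> ln (exp (2 * r) * slack f x)"
      using le pos by (simp_all add: ln_mono)
    then have "ln (slack f x) \<le> 2 * r + ln (slack f p)" "ln (slack f p) \<le> 2 * r + ln (slack f x)"
      using pos by (simp_all add: ln_mult)
    then show ?thesis using B[OF f] by linarith
  qed
  moreover have "B \<ge> 0" unfolding B_def by (intro sum_nonneg) simp
  ultimately show ?thesis using that[of B] by simp
qed

text \<open>
  Each point \<open>p\<close> of the ball has a system of \<open>n\<close> half space functions that is good at \<open>p\<close>, and lies in one of the cells of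
  this system.  There are finitely many systems, each has polynomially many cells that meet the ball, and every cell contributes at
  most a constant.
\<close>

lemma ball_volume_le:
  assumes x: "x \<in> C" and R: "\<And>p f. \<lbrakk>p \<in> hilbert_ball C x r; f \<in> F\<rbrakk> \<Longrightarrow> \<bar>ln (slack f p)\<bar> \<le> real R"
  shows "busemann_volume C (hilbert_ball C x r) \<le>
    of_nat (card F ^ CARD('n) * (2 * R + 3) ^ CARD('n)) *
      (emeasure lborel (ball (0 :: real ^ 'n) 1) * ennreal ((2 * real CARD('n)) ^ CARD('n)))"
proof -
  let ?w = "emeasure lborel (ball (0 :: real ^ 'n) 1)"
  let ?c = "ennreal ((2 * real CARD('n)) ^ CARD('n))"
  let ?d = "ennreal (1 / (2 * real CARD('n)) ^ CARD('n))"
  define \<Sigma> where "\<Sigma> = (UNIV :: 'n set) \<rightarrow>\<^sub>E F"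
  \<comment> \<open>one index more than needed at each end, for the rounding\<close>
  define K where "K = (UNIV :: 'n set) \<rightarrow>\<^sub>E {- int R - 1..int R + 1}"
  have fin: "finite \<Sigma>" "finite K" unfolding \<Sigma>_def K_def using F by (auto intro: finite_PiE)
  have card: "card (\<Sigma> \<times> K) = card F ^ CARD('n) * (2 * R + 3) ^ CARD('n)"
  proof -
    have "card {- int R - 1..int R + 1} = 2 * R + 3" by simp
    then show ?thesis unfolding \<Sigma>_def K_def card_cartesian_product by (simp add: card_funcsetE)
  qed
  define g where "g i = ?w / (?d * emeasure lborel (cell (fst i) (snd i)))" for i
  have le: "?w / emeasure lborel (finsler_ball C p) * indicator (hilbert_ball C x r) p
      \<le> (\<Sum>i\<in>\<Sigma> \<times> K. g i * indicator (cell (fst i) (snd i)) p)" for p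
  proof (cases "p \<in> hilbert_ball C x r")
    case True
    then have pC: "p \<in> C" unfolding hilbert_ball_def by simp
    obtain \<sigma> where \<sigma>': "\<forall>j :: 'n. \<sigma> j \<in> F"
      "\<forall>v. (\<forall>j. \<bar>fst (\<sigma> j) \<bullet> v\<bar> < slack (\<sigma> j) p / CARD('n)) \<longrightarrow> v \<in> sym_body C p"
      using dominating_normals[OF pC] by auto
    have \<sigma>: "\<sigma> j \<in> F" for j using \<sigma>'(1) by simp
    define k where "k j = \<lfloor>ln (slack (\<sigma> j) p)\<rfloor>" for j
    have pk: "p \<in> cell \<sigma> k"
    proof -
      have "exp (k j) \<le> slack (\<sigma> j) p \<and> slack (\<sigma> j) p < exp (k j + 1)" for j
      proof -
        have pos: "0 < slack (\<sigma> j) p" using slack_pos[OF pC \<sigma>] .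
        have "real_of_int (k j) \<le> ln (slack (\<sigma> j) p)" "ln (slack (\<sigma> j) p) < k j + 1" unfolding k_def by linarith+
        then have "exp (k j) \<le> exp (ln (slack (\<sigma> j) p))" "exp (ln (slack (\<sigma> j) p)) < exp (k j + 1)"
          by (simp_all only: exp_le_cancel_iff exp_less_cancel_iff)
        then show ?thesis using pos by simp
      qed
      then show ?thesis unfolding cell_def by simp
    qed
    have "k j \<in> {- int R - 1..int R + 1}" for j
      using R[OF True \<sigma>, of j] unfolding k_def by (simp add: le_floor_iff floor_le_iff) linarith
    then have i: "(\<sigma>, k) \<in> \<Sigma> \<times> K" unfolding \<Sigma>_def K_def using \<sigma> by (auto simp: PiE_def)
    have "?w / emeasure lborel (finsler_ball C p) \<le> g (\<sigma>, k)"
      unfolding g_def fst_conv snd_conv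
      by (rule divide_left_antimono_ennreal[OF cell_volume_le[OF pC pk \<sigma>'(2)]])
    also have "g (\<sigma>, k) = g (\<sigma>, k) * indicator (cell (fst (\<sigma>, k)) (snd (\<sigma>, k))) p" using pk by simp
    also have "\<dots> \<le> (\<Sum>i\<in>\<Sigma> \<times> K. g i * indicator (cell (fst i) (snd i)) p)"
      using fin i by (intro member_le_sum[of "(\<sigma>, k)" "\<Sigma> \<times> K" "\<lambda>i. g i * indicator (cell (fst i) (snd i)) p"]) auto
    finally show ?thesis using True by simp
  qed (simp add: indicator_def)
  have "busemann_volume C (hilbert_ball C x r) \<le> (\<integral>\<^sup>+p. (\<Sum>i\<in>\<Sigma> \<times> K. g i * indicator (cell (fst i) (snd i)) p) \<partial>lborel)"
    unfolding busemann_volume_def by (intro nn_integral_mono le)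
  also have "\<dots> = (\<Sum>i\<in>\<Sigma> \<times> K. g i * emeasure lborel (cell (fst i) (snd i)))"
    using cell_borel by (subst nn_integral_sum) (auto simp: nn_integral_cmult_indicator)
  also have "\<dots> \<le> (\<Sum>i\<in>\<Sigma> \<times> K. ?w * ?c)"
  proof (rule sum_mono)
    fix i
    show "g i * emeasure lborel (cell (fst i) (snd i)) \<le> ?w * ?c"
    proof -
      have "emeasure lborel (cell (fst i) (snd i)) / (?d * emeasure lborel (cell (fst i) (snd i))) \<le> ?c"
      proof (cases "emeasure lborel (cell (fst i) (snd i))")
        case (real l)
        show ?thesis
        proof (cases "l = 0")
          case False
          then have l: "l > 0" using real by simp
          have "ennreal l / (?d * ennreal l) = ennreal (l / ((1 / (2 * real CARD('n)) ^ CARD('n)) * l))"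
            using l by (simp add: ennreal_mult[symmetric] divide_ennreal)
          also have "l / ((1 / (2 * real CARD('n)) ^ CARD('n)) * l) = (2 * real CARD('n)) ^ CARD('n)"
            using l by simp
          finally show ?thesis unfolding real(2) by simp
        qed (simp add: real)
      next
        case top
        then show ?thesis by (simp add: ennreal_mult_top)
      qed
      then show ?thesis unfolding g_def ennreal_divide_times by (intro mult_left_mono) auto
    qed
  qed
  also have "\<dots> = of_nat (card F ^ CARD('n) * (2 * R + 3) ^ CARD('n)) * (?w * ?c)"
    unfolding sum_constant card ..
  finally show ?thesis .
qed

end

section \<open>Growth of balls and polytopes\<close>

lemma open_polytope_upper_asvol_finite:
  fixes C :: "(real ^ 'n) set"
  assumes C: "hilbert_geometry C" and x: "x \<in> C" and poly: "open_polytope C"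
  shows "upper_asvol C x < \<infinity>"
proof -
  let ?n = "CARD('n)"
  obtain F where F: "finite F" "C = {y. \<forall>f\<in>F. 0 < fst f \<bullet> y + snd f}"
    using open_polytope_halfspaces[OF poly] by auto
  obtain B where B: "B \<ge> 0"
    "\<And>r p f. \<lbrakk>p \<in> hilbert_ball C x r; f \<in> F\<rbrakk> \<Longrightarrow> \<bar>ln (slack f p)\<bar> \<le> B + 2 * r"
    using ball_ln_bound[OF C F x] by auto
  define W where "W = emeasure lborel (ball (0 :: real ^ 'n) 1) * ennreal ((2 * real ?n) ^ ?n)"
  have "W < \<infinity>" unfolding W_def
    using emeasure_bounded_finite[of "ball (0::real^'n) 1"] by (simp add: ennreal_mult_less_top)
  then obtain w where w: "W = ennreal w" "0 \<le> w" by (cases W) auto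
  define K where "K = real (card F) ^ ?n * (2 * B + 9) ^ ?n * w"
  have "busemann_volume C (hilbert_ball C x r) / ennreal (r ^ ?n) \<le> ennreal K" if r: "1 \<le> r" for r
  proof -
    define R where "R = nat \<lceil>B + 2 * r\<rceil>"
    have R: "B + 2 * r \<le> real R" "real R \<le> B + 2 * r + 1"
      unfolding R_def using B(1) r by linarith+
    have "busemann_volume C (hilbert_ball C x r) \<le> of_nat (card F ^ ?n * (2 * R + 3) ^ ?n) * W"
      unfolding W_def using B(2) R(1) by (intro ball_volume_le[OF C F x]) (meson order_trans)
    also have "\<dots> = ennreal (real (card F ^ ?n * (2 * R + 3) ^ ?n) * w)"
      unfolding w(1) using w(2) by (simp only: ennreal_of_nat_eq_real_of_nat ennreal_mult of_nat_0_le_iff)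
    also have "\<dots> \<le> ennreal (K * r ^ ?n)"
    proof (rule ennreal_leI)
      have "real (2 * R + 3) \<le> (2 * B + 9) * r"
      proof -
        have "real (2 * R + 3) \<le> 2 * B + 4 * r + 5" using R(2) by simp
        moreover have "2 * B * 1 \<le> 2 * B * r" using B(1) r by (intro mult_left_mono) auto
        ultimately show ?thesis using r by (simp add: algebra_simps)
      qed
      then have "real (2 * R + 3) ^ ?n \<le> ((2 * B + 9) * r) ^ ?n" by (intro power_mono) auto
      then have "real (card F) ^ ?n * real (2 * R + 3) ^ ?n * w \<le> real (card F) ^ ?n * ((2 * B + 9) * r) ^ ?n * w"
        using w(2) by (intro mult_right_mono mult_left_mono) auto
      then show "real (card F ^ ?n * (2 * R + 3) ^ ?n) * w \<le> K * r ^ ?n"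
        unfolding K_def by (simp add: power_mult_distrib mult_ac)
    qed
    finally have "busemann_volume C (hilbert_ball C x r) / ennreal (r ^ ?n) \<le> ennreal (K * r ^ ?n) / ennreal (r ^ ?n)"
      by (rule divide_right_mono_ennreal)
    also have "\<dots> = ennreal K"
    proof -
      have "0 < r ^ ?n" "0 \<le> K" unfolding K_def using r w(2) B(1) by auto
      then show ?thesis using r by (simp add: divide_ennreal)
    qed
    finally show ?thesis .
  qed
  then have "eventually (\<lambda>r. busemann_volume C (hilbert_ball C x r) / ennreal (r ^ ?n) \<le> ennreal K) at_top"
    by (rule eventually_mono[OF eventually_ge_at_top[of 1]])
  then have "upper_asvol C x \<le> ennreal K" unfolding upper_asvol_def by (rule Limsup_bounded)
  then show ?thesis using le_less_trans by fastforce
qed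

text \<open>
  The radius \<open>N * \<kappa>\<close> is twice the logarithmic radius \<open>ln (32 ^ (n * N)) / 2\<close> of the packing, which leaves room for all
  constants once \<open>N\<close> is large.
\<close>

lemma exposed_points_volume:
  fixes C :: "(real ^ 'n) set"
  assumes C: "hilbert_geometry C" and x: "x \<in> C" and dom: "\<And>y. y \<in> C \<Longrightarrow> norm y + 1 \<le> a \<bullet> y + b"
    and E: "finite E" "\<And>e. e \<in> E \<Longrightarrow> \<exists>f. exposed_by (closure (proj a b ` C)) f e"
  defines "\<kappa> \<equiv> real CARD('n) * ln 32"
  shows "\<exists>N0. \<forall>N\<ge>N0. of_nat (card E * N ^ CARD('n)) * (emeasure lborel (ball (0 :: real ^ 'n) 1) / 8 ^ CARD('n))
            \<le> busemann_volume C (hilbert_ball C x (real N * \<kappa>))"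
proof -
  let ?n = "CARD('n)" and ?D = "closure (proj a b ` C)"
  note Cp = hilbert_geometryD[OF C]
  note D = proj_section[OF Cp dom]
  obtain k where k: "?n = Suc k" by (cases ?n) auto
  have dimD: "aff_dim ?D = int (Suc k)" using D(4) k by simp
  have px: "proj a b x \<in> rel_interior ?D" using D(3) x by simp
  obtain c where c: "c \<ge> 1"
    "\<forall>N. \<exists>S. packing ?D (c * 32 ^ (Suc k * N)) (proj a b x) S \<and> card S = card E * N ^ Suc k"
    using exposed_packing[OF D(1,2) px dimD E] by auto
  have kpos: "\<kappa> > 0" unfolding \<kappa>_def by simp
  \<comment> \<open>16 collects a factor 4 from the change to \<open>C\<close> and a factor 4 from the patches\<close>
  obtain N0 :: nat where N0: "ln (16 * c) < real N0 * \<kappa>" using ex_less_of_nat_mult[OF kpos] by auto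
  show ?thesis
  proof (intro exI[of _ N0] allI impI)
    fix N assume N: "N0 \<le> N"
    have big: "ln (16 * c) < real N * \<kappa>"
    proof -
      have "real N0 * \<kappa> \<le> real N * \<kappa>" using N kpos by (intro mult_right_mono) auto
      then show ?thesis using N0 by linarith
    qed
    obtain S where S: "packing ?D (c * 32 ^ (?n * N)) (proj a b x) S" "card S = card E * N ^ ?n"
      using c(2) unfolding k by auto
    obtain T where T: "packing C (4 * (c * 32 ^ (?n * N))) x T" "card T = card S"
      using packing_unproj[OF Cp(1,2) x dom S(1)] by auto
    have sep: "pairwise (\<lambda>y z. \<not> hilbert_near C 16 y z) T" using T(1) unfolding packing_def by simp
    have "patch C y \<subseteq> hilbert_ball C x (real N * \<kappa>)" if y: "y \<in> T" for y
    proof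
      fix z assume z: "z \<in> patch C y"
      have yC: "y \<in> C" using packingD(2)[OF T(1)] y by auto
      have zC: "z \<in> C" by (rule patch_reach(3)[OF Cp(2) yC z])
      let ?K = "4 * (c * 32 ^ (?n * N)) * 4"
      have near: "hilbert_near C ?K x z"
        by (rule hilbert_near_trans[OF Cp(2) packingD(3)[OF T(1) y] patch_hilbert_near[OF Cp(2) yC z]])
      have K1: "1 * 1 \<le> 16 * (c * 32 ^ (?n * N))"
        using c(1) mult_mono[of 1 c 1 "32 ^ (?n * N)"] by simp
      have "hilbert_dist C x z \<le> 1/2 * ln ?K"
        by (rule hilbert_dist_le[OF C x zC near]) (use K1 in simp)
      also have "ln ?K = ln (16 * c) + ln (32 ^ (?n * N))"
        using c(1) by (subst ln_mult_pos[symmetric]) (auto simp: mult_ac)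
      also have "ln ((32::real) ^ (?n * N)) = real N * \<kappa>"
        unfolding \<kappa>_def by (subst ln_realpow) auto
      also have "1/2 * (ln (16 * c) + real N * \<kappa>) < real N * \<kappa>" using big by (simp add: distrib_left)
      finally show "z \<in> hilbert_ball C x (real N * \<kappa>)" unfolding hilbert_ball_def using zC by simp
    qed
    from busemann_volume_ge_packing[OF C packingD(1,2)[OF T(1)] sep this]
    show "of_nat (card E * N ^ ?n) * (emeasure lborel (ball (0 :: real ^ 'n) 1) / 8 ^ ?n)
            \<le> busemann_volume C (hilbert_ball C x (real N * \<kappa>))"
      unfolding T(2) S(2) .
  qed
qed

text \<open>
  If the image of \<open>C\<close> had infinitely many exposed points, any number of them could be used, and the volume of large balls would
  exceed every multiple of \<open>r ^ n\<close>.
\<close>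

lemma upper_asvol_finite_imp_open_polytope:
  fixes C :: "(real ^ 'n) set"
  assumes C: "hilbert_geometry C" and x: "x \<in> C" and fin: "upper_asvol C x < \<infinity>"
    and dom: "\<And>y. y \<in> C \<Longrightarrow> norm y + 1 \<le> a \<bullet> y + b"
  shows "open_polytope C"
proof -
  let ?n = "CARD('n)"
  note Cp = hilbert_geometryD[OF C]
  let ?D = "closure (proj a b ` C)"
  have D: "convex ?D" "compact ?D"
    by (rule proj_section(1)[OF Cp dom], assumption) (rule proj_section(2)[OF Cp dom])
  have "finite {e. \<exists>f. exposed_by ?D f e}"
  proof (rule ccontr)
    assume inf: "infinite {e. \<exists>f. exposed_by ?D f e}"
    define \<kappa> where "\<kappa> = real ?n * ln 32"
    have kpos: "\<kappa> > 0" unfolding \<kappa>_def by simp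
    have "emeasure lborel (ball (0 :: real ^ 'n) 1) < \<infinity>" using emeasure_bounded_finite[of "ball (0::real^'n) 1"] by simp
    moreover have "0 < emeasure lborel (ball (0 :: real ^ 'n) 1)" by (intro emeasure_lborel_open_pos) auto
    ultimately obtain w where w: "emeasure lborel (ball (0 :: real ^ 'n) 1) = ennreal w" "0 < w"
      by (cases "emeasure lborel (ball (0 :: real ^ 'n) 1)") auto
    have w8: "ennreal w / 8 ^ ?n = ennreal (w / 8 ^ ?n)"
    proof -
      have "(8::ennreal) ^ ?n = ennreal (8 ^ ?n)" by (simp add: ennreal_power[symmetric])
      then show ?thesis using w(2) by (simp add: divide_ennreal)
    qed
    obtain L where L: "upper_asvol C x = ennreal L" "0 \<le> L" using fin by (cases "upper_asvol C x") auto
    then have "upper_asvol C x < ennreal (L + 1)" by (simp add: ennreal_lessI)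
    then have "eventually (\<lambda>r. busemann_volume C (hilbert_ball C x r) / ennreal (r ^ ?n) < ennreal (L + 1)) at_top"
      unfolding upper_asvol_def by (rule Limsup_lessD)
    then obtain r0 where r0: "\<And>r. r0 \<le> r \<Longrightarrow>
        busemann_volume C (hilbert_ball C x r) / ennreal (r ^ ?n) < ennreal (L + 1)"
      unfolding eventually_at_top_linorder by auto
    define q where "q = w / 8 ^ ?n / \<kappa> ^ ?n"
    have "q > 0" unfolding q_def using w(2) kpos by simp
    then obtain M :: nat where M: "L + 1 < real M * q" using ex_less_of_nat_mult by auto
    obtain E where E: "finite E" "card E = M" "E \<subseteq> {e. \<exists>f. exposed_by ?D f e}"
      using infinite_arbitrarily_large[OF inf] by auto
    have E': "\<exists>f. exposed_by ?D f e" if "e \<in> E" for e using E(3) that by auto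
    obtain N0 where N0: "\<forall>N\<ge>N0. of_nat (card E * N ^ ?n) * (emeasure lborel (ball (0 :: real ^ 'n) 1) / 8 ^ ?n)
            \<le> busemann_volume C (hilbert_ball C x (real N * \<kappa>))"
      using exposed_points_volume[OF C x dom E(1) E'] unfolding \<kappa>_def by auto
    obtain N1 :: nat where N1: "r0 < real N1 * \<kappa>" using ex_less_of_nat_mult[OF kpos] by auto
    \<comment> \<open>the summand 1 makes the radius positive\<close>
    define N where "N = N0 + N1 + 1"
    define r where "r = real N * \<kappa>"
    have rpos: "r > 0" unfolding r_def N_def using kpos by simp
    have "r0 \<le> r"
    proof -
      have "real N1 * \<kappa> \<le> r" unfolding r_def N_def using kpos by (intro mult_right_mono) auto
      then show ?thesis using N1 by linarith
    qed
    have "N0 \<le> N" unfolding N_def by simp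
    have "ennreal (real M * q) = ennreal (real (M * N ^ ?n) * (w / 8 ^ ?n)) / ennreal (r ^ ?n)"
    proof -
      have "real (M * N ^ ?n) * (w / 8 ^ ?n) / r ^ ?n = real M * q"
        unfolding q_def r_def N_def using kpos by (simp add: power_mult_distrib)
      moreover have "0 < r ^ ?n" using rpos by simp
      ultimately show ?thesis using w(2) by (simp add: divide_ennreal)
    qed
    also have "ennreal (real (M * N ^ ?n) * (w / 8 ^ ?n)) = of_nat (card E * N ^ ?n) * (emeasure lborel (ball (0 :: real ^ 'n) 1) / 8 ^ ?n)"
      unfolding w(1) w8 E(2) using w(2)
      by (subst ennreal_mult) (simp_all only: ennreal_of_nat_eq_real_of_nat of_nat_0_le_iff, simp)
    also have "\<dots> / ennreal (r ^ ?n) \<le> busemann_volume C (hilbert_ball C x r) / ennreal (r ^ ?n)"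
      using N0[rule_format, OF \<open>N0 \<le> N\<close>] unfolding r_def by (rule divide_right_mono_ennreal)
    also have "\<dots> < ennreal (L + 1)" by (rule r0[OF \<open>r0 \<le> r\<close>])
    finally have lt: "ennreal (real M * q) < ennreal (L + 1)" .
    have "0 \<le> real M * q" using \<open>q > 0\<close> by simp
    then have "real M * q < L + 1" using lt by (simp only: ennreal_less_iff)
    then show False using M by simp
  qed
  then have poly: "polytope ?D" by (rule finitely_many_exposed_imp_polytope[OF D])
  show ?thesis by (rule polytope_section_imp_open_polytope[OF Cp dom poly])
qed

theorem proposition5:
  fixes C :: "(real ^ 'n) set" and x :: "real ^ 'n"
  assumes "hilbert_geometry C" and "x \<in> C"
  shows "upper_asvol C x < \<infinity> \<longleftrightarrow> open_polytope C"
proof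
  assume fin: "upper_asvol C x < \<infinity>"
  obtain a b where "\<And>y. y \<in> C \<Longrightarrow> norm y + 1 \<le> a \<bullet> y + b"
    using convex_line_free_dominating_functional[of C] assms(1) unfolding hilbert_geometry_def by auto
  then show "open_polytope C" by (rule upper_asvol_finite_imp_open_polytope[OF assms fin])
next
  assume "open_polytope C"
  then show "upper_asvol C x < \<infinity>" by (rule open_polytope_upper_asvol_finite[OF assms])
qed

end
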